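(* Let $q$ be a prime power, let $n \geq 1$ be an odd integer, and let $r=(q^n+1)/(q+1)$. Let $C_n$ be the generalized GK-curve over $\mathbb{F}_{q^{2n}}$, defined by the equations \[ x^q+x = y^{q+1}, \qquad y^{q^2}-y = z^{r}. \] Let $F$ be the two-variable polynomial over $\mathbb{F}_q$ determined by the identity $F(X+Y,XY) = (X^{q-1}-1)(Y^{q-1}-1)$. Let $Z = Z(t) \in \overline{\mathbb{F}_q}[t]$ be a polynomial in one variable $t$ such that $w = Z^q+Z$ satisfies \[ t\,w\, F(t^r+w+w^q,\;w^{q+1}) = (t^r-t)(t^{qr}-t). \] Then, for any point $(\alpha,\beta,\gamma) \in C_n$, and for $(a,b,c)=( \alpha^{q^n}, \beta^{q^n}, \gamma^{q^n})$, the surface $x+a = by + Z$, where $Z$ is taken at $t=cz$, intersects the curve $C_n$ in \[ (\alpha, \beta, \gamma) \ (q^n \text{ times}) \quad \text{and} \quad (\alpha^{q^{2n}}, \beta^{q^{2n}},\gamma^{q^{2n}}) \ (\text{multiplicity one}). \]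
   Context: The curve $C_n$ is considered as an affine curve in $3$-space with coordinates $x,y,z$, and the point $(\alpha,\beta,\gamma)$ may have coordinates in an extension field, that is, in the algebraic closure $\overline{\mathbb{F}_q}$. The intersection statement means: the zero divisor on the affine curve $C_n$ of the regular function $x+a-by-Z(cz)$ is $q^n(\alpha,\beta,\gamma) + (\alpha^{q^{2n}}, \beta^{q^{2n}},\gamma^{q^{2n}})$. If the two points coincide, the multiplicities add to $q^n+1$. The polynomial $F$ exists and is unique because $(X^{q-1}-1)(Y^{q-1}-1)$ is symmetric in $X$ and $Y$.
   Formalization: The condition Z(0) = 0 is added: the identity determines Z only up to a constant e with e^q + e = 0, and if Z(0) ≠ 0 the surface misses (α, β, γ) for every point of C_n (e.g. q = 2, n = 1, Z = 1, point (0,0,0)), so the claim fails. *)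

theory Defs
  imports
    "HOL-Computational_Algebra.Computational_Algebra"
    "HOL-Algebra.Algebraic_Closure_Type"
    "HOL-Library.Cardinality"
    "HOL-Library.Extended_Nat"
begin

text \<open>
  \<open>F :: 'a poly poly\<close> stands for a polynomial \<open>F(U,V)\<close> with \<open>U\<close> the inner and \<open>V\<close> the outer
  variable.  \<open>subst2 h F u v\<close> is \<open>F(u,v)\<close>, where \<open>h\<close> embeds the coefficients of \<open>F\<close>
  into the ring containing \<open>u\<close> and \<open>v\<close>.
\<close>

definition subst2 :: "('a::zero \<Rightarrow> 'b::comm_ring_1) \<Rightarrow> 'a poly poly \<Rightarrow> 'b \<Rightarrow> 'b \<Rightarrow> 'b" where
  "subst2 h F u v = poly (map_poly (\<lambda>c. poly (map_poly h c) u) F) v"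

text \<open>
  \<open>K[x,y,z]\<close> is \<open>K[x][y][z]\<close>: the innermost variable is \<open>x\<close>, the outermost is \<open>z\<close>.
\<close>

type_synonym 'k poly3 = "'k poly poly poly"

definition Const3 :: "'k::comm_ring_1 \<Rightarrow> 'k poly3" where
  "Const3 a = [:[:[:a:]:]:]"

definition X3 :: "'k::comm_ring_1 poly3" where
  "X3 = [:[:[:0, 1:]:]:]"

definition Y3 :: "'k::comm_ring_1 poly3" where
  "Y3 = [:[:0, 1:]:]"

definition Z3 :: "'k::comm_ring_1 poly3" where
  "Z3 = [:0, 1:]"

type_synonym 'k point = "'k \<times> 'k \<times> 'k"

definition eval3 :: "'k::comm_ring_1 poly3 \<Rightarrow> 'k point \<Rightarrow> 'k" where
  "eval3 f P = (case P of (a, b, c) \<Rightarrow> poly (poly (poly f [:[:c:]:]) [:b:]) a)"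

definition ideal_gen :: "'r::comm_ring_1 set \<Rightarrow> 'r set" where
  "ideal_gen S = module.span (*) S"

fun ideal_power :: "'r::comm_ring_1 set \<Rightarrow> nat \<Rightarrow> 'r set" where
  "ideal_power I 0 = UNIV"
| "ideal_power I (Suc d) = ideal_gen {f * g | f g. f \<in> I \<and> g \<in> ideal_power I d}"

definition zero_locus :: "'k::comm_ring_1 poly3 set \<Rightarrow> 'k point set" where
  "zero_locus I = {P. \<forall>f\<in>I. eval3 f P = 0}"

definition max_ideal_at :: "'k::comm_ring_1 point \<Rightarrow> 'k poly3 set" where
  "max_ideal_at P = {f. eval3 f P = 0}"

text \<open>
  Let \<open>C\<close> be the affine curve with coordinate ring \<open>A = K[x,y,z]/I\<close>, let \<open>P\<close> be a smooth point
  of \<open>C\<close>, and let \<open>M\<close> be the maximal ideal of the local ring \<open>\<O>\<close> of \<open>C\<close> at \<open>P\<close>.  The order at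
  \<open>P\<close> of the regular function represented by \<open>g\<close> is the normalized valuation of the discrete
  valuation ring \<open>\<O>\<close>, that is, the supremum of all \<open>d\<close> such that \<open>g\<close> lies in \<open>M^d\<close>.  In
  terms of representatives, \<open>g\<close> lies in \<open>M^d\<close> iff \<open>s * g\<close> is congruent modulo \<open>I\<close> to an
  element of the \<open>d\<close>-th power of the ideal of \<open>P\<close>, for some denominator \<open>s\<close> that does not vanish
  at \<open>P\<close>.  The value is \<open>\<infinity>\<close> if \<open>g\<close> vanishes in \<open>\<O>\<close>.
\<close>

definition ord_at :: "'k::comm_ring_1 poly3 set \<Rightarrow> 'k point \<Rightarrow> 'k poly3 \<Rightarrow> enat" where
  "ord_at I P g = Sup {enat d | d. \<exists>s. eval3 s P \<noteq> 0 \<and>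
     s * g \<in> ideal_gen (ideal_power (max_ideal_at P) d \<union> I)}"

text \<open>A divisor on a curve is given by its multiplicity function, which is 0 off the curve.\<close>

definition zero_divisor ::
    "'k::comm_ring_1 poly3 set \<Rightarrow> 'k poly3 \<Rightarrow> 'k point \<Rightarrow> enat" where
  "zero_divisor I g P = (if P \<in> zero_locus I then ord_at I P g else 0)"

text \<open>
  For odd \<open>n\<close> the division in the exponent \<open>r\<close> is exact.  Since \<open>r\<close> is congruent to 1 modulo the
  characteristic, the Jacobian matrix of the two equations has rank 2 everywhere; hence the curve
  is smooth and the ideal generated by the equations is its vanishing ideal.
\<close>

definition gk_r :: "nat \<Rightarrow> nat \<Rightarrow> nat" where
  "gk_r q n = (q ^ n + 1) div (q + 1)"

definition gk_ideal :: "nat \<Rightarrow> nat \<Rightarrow> 'k::comm_ring_1 poly3 set" where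
  "gk_ideal q n = ideal_gen
     {X3 ^ q + X3 - Y3 ^ (q + 1), Y3 ^ (q ^ 2) - Y3 - Z3 ^ gk_r q n}"

definition gk_curve :: "nat \<Rightarrow> nat \<Rightarrow> 'k::comm_ring_1 point set" where
  "gk_curve q n = zero_locus (gk_ideal q n)"

definition gk_surface :: "'k::comm_ring_1 poly \<Rightarrow> 'k \<Rightarrow> 'k \<Rightarrow> 'k \<Rightarrow> 'k poly3" where
  "gk_surface Z a b c =
     X3 + Const3 a - Const3 b * Y3 - poly (map_poly Const3 Z) (Const3 c * Z3)"

text \<open>
  The identity \<open>F(x+y, xy) = (x^(q-1) - 1) (y^(q-1) - 1)\<close> in the polynomial ring in \<open>x\<close> (inner
  variable) and \<open>y\<close> (outer variable).
\<close>

definition gk_F_identity :: "nat \<Rightarrow> 'f::comm_ring_1 poly poly \<Rightarrow> bool" where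
  "gk_F_identity q F \<longleftrightarrow>
     (let x = [:[:0, 1:]:]; y = [:0, 1:] in
        subst2 (\<lambda>a. [:[:a:]:]) F (x + y) (x * y) = (x ^ (q - 1) - 1) * (y ^ (q - 1) - 1))"

text \<open>
  The identity \<open>t w F(t^r + w + w^q, w^(q+1)) = (t^r - t) (t^(qr) - t)\<close> with \<open>w = Z^q + Z\<close>,
  over the algebraic closure of the field of coefficients of \<open>F\<close>.  It depends on \<open>Z\<close> only
  through \<open>w\<close>, so it determines \<open>Z\<close> only up to a constant \<open>e\<close> with \<open>e^q + e = 0\<close>; the intended
  \<open>Z\<close> is the one with \<open>Z(0) = 0\<close>, since otherwise the surface \<open>x + a = b y + Z(c z)\<close>
  attached to the point (0,0,0) does not pass through it.
\<close>

definition gk_Z_identity ::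
    "nat \<Rightarrow> nat \<Rightarrow> 'f::field poly poly \<Rightarrow> 'f alg_closure poly \<Rightarrow> bool" where
  "gk_Z_identity q n F Z \<longleftrightarrow>
     (let t = [:0, 1:]; r = gk_r q n; w = Z ^ q + Z in
        t * w * subst2 (\<lambda>a. [:to_ac a:]) F (t ^ r + w + w ^ q) (w ^ (q + 1))
        = (t ^ r - t) * (t ^ (q * r) - t))"

end

theory Submission
  imports Defs
begin

text \<open>
  Write \<open>K\<close> for the algebraic closure, \<open>Q = q^n\<close>, \<open>P = (\<alpha>, \<beta>, \<gamma>)\<close>, \<open>P' = P^(Q^2)\<close> for the second
  point of the divisor, and \<open>f = x + a - b y - Z(c z)\<close> for the equation of the surface, where
  \<open>(a, b, c) = P^Q\<close>.

  Where \<open>f\<close> can vanish.  On the curve \<open>f^q + f = w\<^sub>0 - w\<close>, where \<open>w\<^sub>0 = (y^q - b) (y - b^q)\<close> and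
  \<open>w = Z^q + Z\<close> is taken at \<open>t = c z\<close>.  Put \<open>G(u) = u F(t^r + u + u^q, u^(q+1))\<close>.  The identity for
  \<open>F\<close> is used with \<open>X = (y^q - b)^(q+1)\<close> and \<open>Y = (y - b^q)^(q+1)\<close>, for which \<open>X + Y = t^r + w\<^sub>0 + w\<^sub>0^q\<close>
  and \<open>X Y = w\<^sub>0^(q+1)\<close>; it evaluates \<open>G(w\<^sub>0)\<close>, while the identity for \<open>Z\<close> evaluates \<open>G(w)\<close>.  The
  difference is \<open>G(w) - G(w\<^sub>0) = (z^Q - c) (c^Q - z)\<close>, and \<open>w - w\<^sub>0\<close> divides it.  Hence \<open>f\<close> divides
  \<open>(z^Q - c) (c^Q - z)\<close> (\<open>surface_dvd\<close>), so a zero of \<open>f\<close> lies over \<open>z = \<gamma>\<close> or over \<open>z = \<gamma>^(Q^2)\<close>.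
  A computation with Frobenius powers (\<open>second_zero_in_fibre\<close>, \<open>surface_zeros\<close>) leaves only \<open>P\<close>
  and \<open>P'\<close>.

  Why \<open>P\<close> has multiplicity at least \<open>Q\<close>.  The function \<open>x + x^Q - y^(Q+1) - Z(z^(Q+1))\<close> vanishes
  identically on the curve (\<open>Z_on_curve\<close>).  Indeed \<open>w\<close>, taken at \<open>t = z^(Q+1)\<close>, and
  \<open>(y^(qQ) - y) (y^Q - y^q)\<close> are two polynomials in \<open>y\<close> without constant term that solve the same
  equation \<open>G(u) = (t^(r-1) - 1) (t^(qr) - t)\<close>, and such a solution is unique
  (\<open>w_composition\<close>).  Subtracting the identity from \<open>f\<close> leaves a linear combination of
  \<open>(x - \<alpha>)^Q\<close>, \<open>(y - \<beta>)^Q\<close> and \<open>(z - \<gamma>)^Q\<close> with regular functions as coefficients.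

  Exact multiplicities.  Everywhere \<open>\<tau> = z - \<gamma>\<close> is a local parameter, and the order of a function
  at \<open>P\<close> is the order in \<open>\<tau>\<close> of its expansion along the branch over \<open>K[[\<tau>]]\<close> (\<open>ord_at_branch\<close>).
  The coefficient of \<open>\<tau>^Q\<close> in \<open>f\<close> at \<open>P\<close> is a quantity \<open>\<kappa>\<close>, and the linear coefficient of \<open>f\<close> at
  \<open>P'\<close> is the negative of the same quantity for \<open>P^Q\<close>.  One has \<open>\<kappa> = 0\<close> exactly if \<open>P' = P\<close>
  (\<open>\<kappa>_eq_0_iff\<close>).  If \<open>P' \<noteq> P\<close>, the orders are therefore \<open>Q\<close> and 1.  If \<open>P' = P\<close>, the order is at
  least \<open>Q + 1\<close>, and it is at most \<open>Q + 1\<close> because \<open>f\<close> divides \<open>(z^Q - c) (c^Q - z) = - \<tau>^(Q+1)\<close>.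
\<close>

section \<open>Ring homomorphisms and polynomial evaluation\<close>

text \<open>
  A predicate on functions, so that composites such as coefficientwise maps followed by evaluation
  can be handled by ordinary function composition.
\<close>

definition ring_map :: "('a::comm_ring_1 \<Rightarrow> 'b::comm_ring_1) \<Rightarrow> bool" where
  "ring_map h \<longleftrightarrow> h 0 = 0 \<and> h 1 = 1 \<and> (\<forall>x y. h (x + y) = h x + h y) \<and> (\<forall>x y. h (x * y) = h x * h y)"

lemma ring_map_simps:
  assumes "ring_map h"
  shows "h 0 = 0" "h 1 = 1" "h (x + y) = h x + h y" "h (x * y) = h x * h y"
    "h (- x) = - h x" "h (x - y) = h x - h y" "h (x ^ k) = h x ^ k"
proof -
  show 1: "h 0 = 0" "h 1 = 1" "\<And>x y. h (x + y) = h x + h y" "\<And>x y. h (x * y) = h x * h y"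
    using assms by (auto simp: ring_map_def)
  show 2: "h (- x) = - h x" for x
    using 1(3)[of x "- x"] 1(1) by (simp add: eq_neg_iff_add_eq_0 add.commute)
  show "h (x - y) = h x - h y"
    using 1(3)[of x "- y"] 2 by simp
  show "h (x ^ k) = h x ^ k"
    by (induction k) (simp_all add: 1)
qed

lemma ring_map_sum:
  assumes "ring_map h"
  shows "h (\<Sum>i\<in>A. f i) = (\<Sum>i\<in>A. h (f i))"
  by (induction A rule: infinite_finite_induct) (simp_all add: ring_map_simps[OF assms])

lemma ring_map_map_poly:
  assumes "ring_map h"
  shows "ring_map (map_poly h)"
proof -
  note h = ring_map_simps[OF assms]
  have "map_poly h (p * s) = map_poly h p * map_poly h s" for p s
    by (rule poly_eqI) (simp add: coeff_map_poly h coeff_mult ring_map_sum[OF assms])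
  moreover have "map_poly h (p + s) = map_poly h p + map_poly h s" for p s
    by (rule poly_eqI) (simp add: coeff_map_poly h)
  ultimately show ?thesis
    by (simp add: ring_map_def h)
qed

lemma ring_map_comp: "ring_map g \<Longrightarrow> ring_map h \<Longrightarrow> ring_map (\<lambda>x. g (h x))"
  by (simp add: ring_map_def)

lemma ring_map_id: "ring_map (\<lambda>x. x)"
  by (simp add: ring_map_def)

lemma ring_map_poly: "ring_map (\<lambda>p. poly p x)"
  by (simp add: ring_map_def)

lemma ring_map_const_poly: "ring_map (\<lambda>a. [:a:])"
  by (simp add: ring_map_def one_pCons)

lemma ring_map_fps_const: "ring_map fps_const"
  by (simp add: ring_map_def)

lemma ring_map_fps_nth_0: "ring_map (\<lambda>f. fps_nth f 0)"
  by (simp add: ring_map_def)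

lemma ring_map_to_ac: "ring_map to_ac"
  by (simp add: ring_map_def)

lemma map_poly_pCons_ring_map:
  assumes "ring_map h"
  shows "map_poly h (pCons a p) = pCons (h a) (map_poly h p)"
  by (simp add: map_poly_pCons ring_map_simps[OF assms])

lemma poly_map_poly_ring_map:
  assumes "ring_map h"
  shows "poly (map_poly h p) (h x) = h (poly p x)"
  by (induction p) (simp_all add: map_poly_pCons_ring_map[OF assms] ring_map_simps[OF assms])

lemma ring_map_poly_map_poly:
  assumes g: "ring_map g" and h: "ring_map h"
  shows "g (poly (map_poly h p) u) = poly (map_poly (\<lambda>a. g (h a)) p) (g u)"
  by (induction p) (simp_all add: map_poly_pCons_ring_map[OF h] map_poly_pCons_ring_map[OF ring_map_comp[OF g h]]
      ring_map_simps[OF g])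

lemma subst2_ring_map:
  assumes "ring_map g" "ring_map h"
  shows "g (subst2 h F u v) = subst2 (\<lambda>a. g (h a)) F (g u) (g v)"
proof -
  have *: "map_poly (\<lambda>a. g (h a)) p = map_poly g (map_poly h p)" for p
    by (rule poly_eqI) (simp add: coeff_map_poly ring_map_simps[OF assms(1)] ring_map_simps[OF assms(2)])
  have **: "poly (map_poly (\<lambda>a. g (h a)) c) (g u) = g (poly (map_poly h c) u)" for c
    by (simp add: * poly_map_poly_ring_map[OF assms(1)])
  have "map_poly (\<lambda>c. g (poly (map_poly h c) u)) F = map_poly g (map_poly (\<lambda>c. poly (map_poly h c) u) F)"
    by (rule poly_eqI) (simp add: coeff_map_poly ring_map_simps[OF assms(1)])
  thus ?thesis
    by (simp add: subst2_def ** poly_map_poly_ring_map[OF assms(1)])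
qed

lemma poly_diff_dvd: "x - y dvd poly p x - poly p (y::'a::comm_ring_1)"
proof (induction p)
  case (pCons a p)
  have "poly (pCons a p) x - poly (pCons a p) y = x * (poly p x - poly p y) + (x - y) * poly p y"
    by (simp add: algebra_simps)
  thus ?case using pCons by (simp add: dvd_add)
qed auto

text \<open>
  The coefficients of \<open>F\<close> are constants, so \<open>F(u,v)\<close> depends on \<open>u\<close> and \<open>v\<close> only modulo any
  common divisor of the two differences.
\<close>

lemma subst2_diff_dvd:
  fixes d :: "'b::comm_ring_1"
  assumes h: "ring_map h" and u: "d dvd u - u'" and v: "d dvd v - v'"
  shows "d dvd subst2 h F u v - subst2 h F u' v'"
proof -
  have 0: "map_poly (\<lambda>c. poly (map_poly h c) u) (pCons a p) =
     pCons (poly (map_poly h a) u) (map_poly (\<lambda>c. poly (map_poly h c) u) p)" for a p u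
    by (simp add: map_poly_pCons)
  have "d dvd poly (map_poly (\<lambda>c. poly (map_poly h c) u) F) v - poly (map_poly (\<lambda>c. poly (map_poly h c) u') F) v"
  proof (induction F)
    case (pCons a p)
    have "d dvd poly (map_poly h a) u - poly (map_poly h a) u'"
      using poly_diff_dvd u dvd_trans by blast
    moreover have "poly (map_poly (\<lambda>c. poly (map_poly h c) u) (pCons a p)) v
        - poly (map_poly (\<lambda>c. poly (map_poly h c) u') (pCons a p)) v
      = (poly (map_poly h a) u - poly (map_poly h a) u') + v * (poly (map_poly (\<lambda>c. poly (map_poly h c) u) p) v
        - poly (map_poly (\<lambda>c. poly (map_poly h c) u') p) v)"
      by (simp add: 0 algebra_simps)
    ultimately show ?case using pCons by simp
  qed auto
  moreover have "d dvd poly (map_poly (\<lambda>c. poly (map_poly h c) u') F) v - poly (map_poly (\<lambda>c. poly (map_poly h c) u') F) v'"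
    using poly_diff_dvd v dvd_trans by blast
  ultimately have "d dvd (poly (map_poly (\<lambda>c. poly (map_poly h c) u) F) v - poly (map_poly (\<lambda>c. poly (map_poly h c) u') F) v)
     + (poly (map_poly (\<lambda>c. poly (map_poly h c) u') F) v - poly (map_poly (\<lambda>c. poly (map_poly h c) u') F) v')"
    by (rule dvd_add)
  thus ?thesis by (simp add: subst2_def)
qed

lemma poly_Taylor_square:
  fixes u e :: "'a::idom"
  shows "\<exists>s. poly p (u + e) = poly p u + e * poly (pderiv p) u + e ^ 2 * s"
proof (induction p)
  case (pCons a p)
  then obtain s where s: "poly p (u + e) = poly p u + e * poly (pderiv p) u + e ^ 2 * s" by blast
  have "poly (pCons a p) (u + e) = poly (pCons a p) u + e * poly (pderiv (pCons a p)) u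
     + e ^ 2 * (poly (pderiv p) u + (u + e) * s)"
    unfolding poly_pCons pderiv_pCons poly_add s power2_eq_square by (simp add: s power2_eq_square algebra_simps)
  thus ?case by blast
qed auto

lemma map_poly_fps_const_pderiv:
  fixes p :: "'k::idom poly"
  shows "pderiv (map_poly fps_const p) = map_poly fps_const (pderiv p)"
  by (rule poly_eqI) (simp add: coeff_pderiv coeff_map_poly fps_of_nat[symmetric] fps_const_mult)

section \<open>The Frobenius map of a finite field\<close>

lemma finite_field_power_card:
  fixes x :: "'f::{field, finite}"
  shows "x ^ CARD('f) = x"
proof (cases "x = 0")
  case False
  let ?U = "UNIV - {0::'f}"
  have "bij_betw (\<lambda>y. x * y) ?U ?U"
    using False by (intro bij_betw_byWitness[where f' = "\<lambda>y. y / x"]) auto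
  hence "prod (\<lambda>y. x * y) ?U = prod (\<lambda>y. y) ?U"
    by (rule prod.reindex_bij_betw)
  hence "x ^ card ?U * \<Prod>?U = \<Prod>?U"
    by (simp add: prod.distrib)
  hence "x ^ card ?U = 1" by simp
  moreover have "CARD('f) = Suc (card ?U)"
    by (rule card.remove) auto
  ultimately show ?thesis by (simp only: power_Suc mult_1_right)
qed auto

lemma card_field_gt_1: "CARD('f::{field, finite}) > 1"
proof -
  have "card {0, 1 :: 'f} \<le> CARD('f)" by (intro card_mono) auto
  thus ?thesis by simp
qed

text \<open>
  The polynomial \<open>(x + 1)^q - x^q - 1\<close> has degree less than \<open>q\<close> and vanishes at all \<open>q\<close> elements
  of the field, since \<open>a^q = a\<close> there; so its coefficients vanish.  This is what makes the
  \<open>q\<close>-th power map additive in every ring of the same characteristic.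
\<close>

lemma finite_field_binomial_zero:
  assumes "0 < i" "i < CARD('f)"
  shows "of_nat (CARD('f) choose i) = (0 :: 'f::{field, finite})"
proof -
  let ?q = "CARD('f)"
  define p where "p = (\<Sum>j\<in>{0<..<?q}. monom (of_nat (?q choose j) :: 'f) j)"
  have "poly p x = 0" for x
  proof -
    have "x + 1 = (x + 1) ^ ?q" by (simp add: finite_field_power_card)
    also have "\<dots> = (\<Sum>j\<le>?q. of_nat (?q choose j) * x ^ j)"
      by (simp add: binomial_ring)
    also have "{..?q} = insert 0 (insert ?q {0<..<?q})"
      by auto
    also have "(\<Sum>j\<in>insert 0 (insert ?q {0<..<?q}). of_nat (?q choose j) * x ^ j) = 1 + (x ^ ?q + poly p x)"
      by (simp add: p_def poly_sum poly_monom)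
    finally show ?thesis by (simp add: finite_field_power_card)
  qed
  moreover have "degree p < ?q"
    unfolding p_def
  proof (rule degree_sum_less)
    fix j assume "j \<in> {0<..<?q}"
    thus "degree (monom (of_nat (?q choose j) :: 'f) j) < ?q"
      using degree_monom_le[of "of_nat (?q choose j) :: 'f" j] by simp
  qed simp
  ultimately have "p = 0"
    using card_poly_roots_bound[of p] by fastforce
  moreover have "coeff p i = of_nat (?q choose i)"
    using assms by (simp add: p_def coeff_sum if_distrib cong: if_cong)
  ultimately show ?thesis by simp
qed

lemma finite_field_add_power:
  fixes a b :: "'r::comm_ring_1"
  assumes char: "CHAR('r) = CHAR('f::{field, finite})"
  shows "(a + b) ^ CARD('f) = a ^ CARD('f) + b ^ CARD('f)"
proof -
  let ?q = "CARD('f)"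
  have 0: "of_nat (?q choose i) = (0::'r)" if "0 < i" "i < ?q" for i
    using finite_field_binomial_zero[where 'f = 'f, OF that] by (simp add: of_nat_eq_0_iff_char_dvd char)
  have "(a + b) ^ ?q = (\<Sum>j\<le>?q. of_nat (?q choose j) * a ^ j * b ^ (?q - j))"
    by (rule binomial_ring)
  also have "\<dots> = (\<Sum>j\<in>{0, ?q}. of_nat (?q choose j) * a ^ j * b ^ (?q - j))"
  proof (rule sum.mono_neutral_right)
    show "\<forall>i\<in>{..?q} - {0, ?q}. of_nat (?q choose i) * a ^ i * b ^ (?q - i) = 0"
    proof
      fix i assume "i \<in> {..?q} - {0, ?q}"
      hence "of_nat (?q choose i) = (0::'r)" using 0[of i] by auto
      thus "of_nat (?q choose i) * a ^ i * b ^ (?q - i) = 0" by simp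
    qed
  qed auto
  also have "\<dots> = a ^ ?q + b ^ ?q" by simp
  finally show ?thesis .
qed

lemma finite_field_of_nat_card:
  assumes char: "CHAR('r::comm_ring_1) = CHAR('f::{field, finite})"
  shows "of_nat CARD('f) = (0::'r)"
  using finite_field_binomial_zero[where 'f = 'f, of 1] card_field_gt_1[where 'f = 'f]
  by (simp add: of_nat_eq_0_iff_char_dvd char)

section \<open>Powers of the Frobenius map\<close>

definition frob :: "nat \<Rightarrow> nat \<Rightarrow> 'r::comm_ring_1 \<Rightarrow> 'r" where
  "frob q i x = x ^ (q ^ i)"

lemma ring_map_commute_frob:
  assumes "ring_map h"
  shows "h (frob q i x) = frob q i (h x)"
  by (simp add: frob_def ring_map_simps[OF assms])

lemmas frob_fps_const = ring_map_commute_frob[OF ring_map_fps_const, symmetric]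
lemmas frob_fps_nth_0 = ring_map_commute_frob[OF ring_map_fps_nth_0]

text \<open>
  The parameter \<open>ty\<close> only names the ring, so that the same exponent can be used at once for the
  field, its polynomial ring and its power series ring.
\<close>

locale frobenius_ring =
  fixes q :: nat and ty :: "'r::idom itself"
  assumes q_gt_1: "q > 1" and add_power: "(a + b :: 'r) ^ q = a ^ q + b ^ q"
begin

lemma frob_add: "frob q i (a + b :: 'r) = frob q i a + frob q i b"
proof (induction i arbitrary: a b)
  case (Suc i)
  have "frob q (Suc i) c = frob q i (c ^ q)" for c :: 'r
    by (simp add: frob_def power_mult)
  thus ?case by (simp add: add_power Suc)
qed (simp add: frob_def)

lemma ring_map_frob: "ring_map (frob q i :: 'r \<Rightarrow> 'r)"
  using q_gt_1 by (simp add: ring_map_def frob_add) (simp add: frob_def power_mult_distrib)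

lemmas frob_simps [simp] = ring_map_simps[OF ring_map_frob]

lemma frob_frob [simp]: "frob q i (frob q j x) = frob q (i + j) (x :: 'r)"
  by (simp add: frob_def power_add mult.commute flip: power_mult)

lemma frob_0 [simp]: "frob q 0 x = (x :: 'r)"
  by (simp add: frob_def)

lemma frob_inj: "frob q i a = frob q i b \<Longrightarrow> a = (b :: 'r)"
proof -
  assume "frob q i a = frob q i b"
  hence "frob q i (a - b) = 0" by simp
  thus "a = b" by (simp add: frob_def)
qed

lemma frob_eq_iff [simp]: "frob q i a = frob q i b \<longleftrightarrow> a = (b :: 'r)"
  using frob_inj by blast

lemma power_q: "(x :: 'r) ^ q = frob q 1 x"
  by (simp add: frob_def)

lemma power_q_plus_1: "(x :: 'r) ^ (q + 1) = x * frob q 1 x"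
  by (simp add: frob_def)

text \<open>
  The sum telescopes.  On the curve \<open>x + x^q\<close> is a polynomial in \<open>y\<close>, and so is then \<open>x + x^Q\<close>.
\<close>

lemma frob_alternating_sum:
  fixes x :: 'r
  assumes "odd n"
  shows "(\<Sum>i<n. (-1) ^ i * frob q i (x + frob q 1 x)) = x + frob q n x"
proof -
  have "(\<Sum>i<m. (-1) ^ i * frob q i (x + frob q 1 x)) = x - (-1) ^ m * frob q m x" for m
    by (induction m) (simp_all add: algebra_simps)
  thus ?thesis using assms by simp
qed

lemma frob_iterate_fixed:
  fixes u :: 'r
  assumes "frob q 2 u = u"
  shows "frob q (2 * i) u = u"
proof (induction i)
  case (Suc i)
  have "frob q (2 * Suc i) u = frob q (2 * i) (frob q 2 u)" by (simp add: add.commute)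
  thus ?case using Suc assms by simp
qed simp

end

section \<open>The identities for F and Z at elements of a ring\<close>

lemma gk_r_times:
  assumes "odd n"
  shows "gk_r q n * (q + 1) = q ^ n + 1"
proof -
  have "(int q + 1) dvd int q ^ n - (-1) ^ n"
    using power_diff_sumr2[of "int q" n "-1"] by (simp add: dvd_def)
  hence "int (q + 1) dvd int (q ^ n + 1)"
    using assms by (simp add: algebra_simps)
  hence "q + 1 dvd q ^ n + 1" by (simp only: int_dvd_int_iff)
  thus ?thesis unfolding gk_r_def by (rule dvd_div_mult_self)
qed

lemma gk_r_pos: "odd n \<Longrightarrow> gk_r q n > 0"
  using gk_r_times[of n q] by (cases "gk_r q n") auto

text \<open>
  The identity holds in the polynomial ring in two variables, hence after any substitution.
\<close>

lemma gk_F_identity_eval: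
  fixes h :: "'f::comm_ring_1 \<Rightarrow> 'r::comm_ring_1"
  assumes F: "gk_F_identity q F" and h: "ring_map h"
  shows "subst2 h F (u + v) (u * v) = (u ^ (q - 1) - 1) * (v ^ (q - 1) - 1)"
proof -
  define \<Phi> where "\<Phi> p = poly (map_poly (\<lambda>c. poly (map_poly h c) u) p) v" for p
  have 1: "ring_map (\<lambda>c. poly (map_poly h c) u)"
    by (rule ring_map_comp[OF ring_map_poly ring_map_map_poly[OF h]])
  have \<Phi>: "ring_map \<Phi>"
    unfolding \<Phi>_def by (rule ring_map_comp[OF ring_map_poly ring_map_map_poly[OF 1]])
  have vals: "\<Phi> [:[:a:]:] = h a" "\<Phi> [:[:0, 1:]:] = u" "\<Phi> [:0, 1:] = v" for a
    by (simp_all add: \<Phi>_def map_poly_pCons_ring_map[OF 1] map_poly_pCons_ring_map[OF h]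
        ring_map_simps[OF h] ring_map_simps[OF 1])
  have 2: "ring_map (\<lambda>a::'f. [:[:a:]:])"
    by (rule ring_map_comp[OF ring_map_const_poly ring_map_const_poly])
  note F = F[unfolded gk_F_identity_def Let_def, THEN arg_cong[where f = \<Phi>]]
  show ?thesis
    using F unfolding subst2_ring_map[OF \<Phi> 2] ring_map_simps[OF \<Phi>] vals .
qed

text \<open>
  The factor \<open>t\<close> can be cancelled as long as \<open>t\<close> is a variable; only then is \<open>t\<close> specialized, so the
  cancelled identity also holds at \<open>t = 0\<close>.
\<close>

lemma gk_Z_identity_eval:
  fixes F :: "'f::field poly poly" and h :: "'f alg_closure \<Rightarrow> 'r::comm_ring_1" and t :: 'r
  assumes Z: "gk_Z_identity q n F Z" and n: "odd n" and h: "ring_map h"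
  defines "r \<equiv> gk_r q n" and "w \<equiv> poly (map_poly h (Z ^ q + Z)) t"
  shows "w * subst2 (\<lambda>a. h (to_ac a)) F (t ^ r + w + w ^ q) (w ^ (q + 1)) = (t ^ (r - 1) - 1) * (t ^ (q * r) - t)"
proof -
  define \<Phi> where "\<Phi> p = poly (map_poly h p) t" for p
  have \<Phi>: "ring_map \<Phi>"
    unfolding \<Phi>_def by (rule ring_map_comp[OF ring_map_poly ring_map_map_poly[OF h]])
  have vals: "\<Phi> [:a:] = h a" "\<Phi> [:0, 1:] = t" for a
    by (simp_all add: \<Phi>_def map_poly_pCons_ring_map[OF h] ring_map_simps[OF h])
  have c: "ring_map (\<lambda>a::'f. [:to_ac a:])"
    by (rule ring_map_comp[OF ring_map_const_poly ring_map_to_ac])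
  let ?t = "[:0, 1::'f alg_closure:]"
  define W where "W = Z ^ q + Z"
  have w: "\<Phi> W = w" by (simp add: W_def w_def \<Phi>_def)
  have r: "?t ^ r = ?t * ?t ^ (r - 1)"
    using gk_r_pos[OF n, of q] by (cases r) (simp_all add: r_def)
  have factor: "a = x * b \<Longrightarrow> (a - x) * y = x * ((b - 1) * y)" for a b x y :: "'f alg_closure poly"
    by (simp add: algebra_simps)
  have "?t * (W * subst2 (\<lambda>a. [:to_ac a:]) F (?t ^ r + W + W ^ q) (W ^ (q + 1)))
      = ?t * ((?t ^ (r - 1) - 1) * (?t ^ (q * r) - ?t))"
    using Z factor[OF r] by (simp only: gk_Z_identity_def Let_def mult.assoc r_def[symmetric] W_def[symmetric])
  hence "W * subst2 (\<lambda>a. [:to_ac a:]) F (?t ^ r + W + W ^ q) (W ^ (q + 1))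
      = (?t ^ (r - 1) - 1) * (?t ^ (q * r) - ?t)"
    by (subst (asm) mult_left_cancel) auto
  from arg_cong[OF this, of \<Phi>] show ?thesis
    unfolding ring_map_simps[OF \<Phi>] subst2_ring_map[OF \<Phi> c] vals w .
qed

context frobenius_ring
begin

text \<open>
  With \<open>u = y^q - b\<close> and \<open>v = y - b^q\<close>, the products \<open>u^(q+1)\<close> and \<open>v^(q+1)\<close> have sum
  \<open>t^r + w + w^q\<close> and product \<open>w^(q+1)\<close>, so the identity for \<open>F\<close> evaluates the left-hand side to
  \<open>(u^(q^2) - u) (v^(q^2) - v)\<close>.
\<close>

lemma expected_w_identity:
  fixes y b t :: 'r and h :: "'f::comm_ring_1 \<Rightarrow> 'r"
  assumes F: "gk_F_identity q F" and h: "ring_map h"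
    and t: "t ^ r = (frob q 2 b - b) * (frob q 2 y - y)"
  defines "w \<equiv> (frob q 1 y - b) * (y - frob q 1 b)"
    and "g \<equiv> frob q 2 y - y" and "e \<equiv> frob q 2 b - b"
  shows "w * subst2 h F (t ^ r + w + w ^ q) (w ^ (q + 1)) = (frob q 1 g - e) * (g - frob q 1 e)"
proof -
  define u where "u = frob q 1 y - b"
  define v where "v = y - frob q 1 b"
  have w: "w = u * v" by (simp add: w_def u_def v_def)
  have sum: "t ^ r + w + w ^ q = u * frob q 1 u + v * frob q 1 v"
    by (simp add: t w_def u_def v_def power_q numeral_2_eq_2 algebra_simps)
  have prod: "w ^ (q + 1) = (u * frob q 1 u) * (v * frob q 1 v)"
    unfolding power_q_plus_1 by (simp add: w_def u_def v_def)
  have reduce: "c * (c * frob q 1 c) ^ (q - 1) = frob q 2 c" for c :: 'r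
  proof -
    have "1 + (q + 1) * (q - 1) = q ^ 2"
      using q_gt_1 by (cases q) (simp_all add: power2_eq_square)
    hence "c ^ (q ^ 2) = c ^ 1 * (c ^ (q + 1)) ^ (q - 1)"
      by (metis power_add power_mult)
    thus ?thesis by (simp add: frob_def)
  qed
  have "w * subst2 h F (t ^ r + w + w ^ q) (w ^ (q + 1))
      = (u * (u * frob q 1 u) ^ (q - 1) - u) * (v * (v * frob q 1 v) ^ (q - 1) - v)"
    unfolding sum prod gk_F_identity_eval[OF F h] unfolding w by (simp add: algebra_simps)
  also have "\<dots> = (frob q 1 g - e) * (g - frob q 1 e)"
    unfolding reduce by (simp add: u_def v_def g_def e_def numeral_2_eq_2 algebra_simps)
  finally show ?thesis .
qed

lemma dvd_F_difference:
  fixes t w w' :: 'r and h :: "'f::comm_ring_1 \<Rightarrow> 'r"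
  assumes h: "ring_map h"
  shows "w - w' dvd subst2 h F (t ^ r + w + w ^ q) (w ^ (q + 1)) - subst2 h F (t ^ r + w' + w' ^ q) (w' ^ (q + 1))"
proof (rule subst2_diff_dvd[OF h])
  have pow: "w - w' dvd w ^ k - w' ^ k" for k
    by (simp add: power_diff_sumr2)
  show "w - w' dvd w ^ (q + 1) - w' ^ (q + 1)" by (rule pow)
  have "t ^ r + w + w ^ q - (t ^ r + w' + w' ^ q) = (w - w') + (w ^ q - w' ^ q)" by simp
  thus "w - w' dvd t ^ r + w + w ^ q - (t ^ r + w' + w' ^ q)" using pow[of q] by (metis dvd_add dvd_refl)
qed

lemma power_r_Frobenius:
  fixes z :: 'r
  assumes "odd n"
  shows "z ^ gk_r q n * frob q 1 (z ^ gk_r q n) = z * frob q n z"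
proof -
  have "z ^ gk_r q n * frob q 1 (z ^ gk_r q n) = z ^ (gk_r q n * (q + 1))"
    by (simp add: frob_def power_add power_mult_distrib flip: power_mult)
  also have "\<dots> = z * frob q n z"
    unfolding gk_r_times[OF assms] by (simp add: frob_def)
  finally show ?thesis .
qed

lemma gk_Z_rhs_expand:
  fixes t :: 'r
  assumes "odd n"
  defines "r \<equiv> gk_r q n"
  shows "(t ^ (r - 1) - 1) * (t ^ (q * r) - t) = frob q n t - t ^ r - frob q 1 (t ^ r) + t"
proof -
  have r: "t ^ r = t * t ^ (r - 1)"
    using gk_r_pos[OF assms(1), of q] by (cases r) (simp_all add: r_def)
  have "r - 1 + q * r = q ^ n"
    using gk_r_times[OF assms(1), of q] gk_r_pos[OF assms(1), of q] by (simp add: r_def algebra_simps)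
  hence "t ^ (r - 1) * t ^ (q * r) = frob q n t"
    by (simp add: frob_def flip: power_add)
  moreover have "t ^ (q * r) = frob q 1 (t ^ r)"
    by (simp add: frob_def mult.commute flip: power_mult)
  ultimately show ?thesis
    by (simp add: r algebra_simps)
qed

end

section \<open>The function w on the curve\<close>

lemma frobenius_ring_finite_field:
  assumes "CHAR('r::idom) = CHAR('f::{field, finite})"
  shows "frobenius_ring TYPE('r) CARD('f)"
  using card_field_gt_1[where 'f = 'f] finite_field_add_power[where 'f = 'f and 'r = 'r, OF assms]
  by unfold_locales auto

locale gk_setting =
  fixes q n :: nat and F :: "'f::{field, finite} poly poly" and Z :: "'f alg_closure poly"
  assumes q_eq: "q = CARD('f)" and odd_n: "odd n"
    and F_identity: "gk_F_identity q F" and Z_identity: "gk_Z_identity q n F Z" and Z_0: "poly Z 0 = 0"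
begin

abbreviation r where "r \<equiv> gk_r q n"

sublocale K: frobenius_ring q "TYPE('f alg_closure)"
  using frobenius_ring_finite_field[where 'r = "'f alg_closure" and 'f = 'f] by (simp add: q_eq)

sublocale K_poly: frobenius_ring q "TYPE('f alg_closure poly)"
  using frobenius_ring_finite_field[where 'r = "'f alg_closure poly" and 'f = 'f] by (simp add: q_eq)

sublocale K_fps: frobenius_ring q "TYPE('f alg_closure fps)"
  using frobenius_ring_finite_field[where 'r = "'f alg_closure fps" and 'f = 'f] by (simp add: q_eq)

lemma of_nat_q: "of_nat q = (0 :: 'f alg_closure)"
  using finite_field_of_nat_card[where 'r = "'f alg_closure" and 'f = 'f] by (simp add: q_eq)

text \<open>
  So the derivative of \<open>z^r\<close> is \<open>z^(r-1)\<close>.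
\<close>

lemma of_nat_r: "of_nat r = (1 :: 'f alg_closure)"
proof -
  have "of_nat (r * (q + 1)) = (of_nat (q ^ n + 1) :: 'f alg_closure)"
    by (simp only: gk_r_times[OF odd_n])
  moreover have "n \<noteq> 0" using odd_n by (metis even_zero)
  ultimately show ?thesis by (simp add: of_nat_q)
qed

text \<open>
  Subtract the values of \<open>u F(t^r + u + u^q, u^(q+1))\<close> at \<open>w\<close> and at \<open>w\<^sub>0 = (y^q - b) (y - b^q)\<close>:
  the right-hand sides of the two identities differ by \<open>(z^Q - c) (c^Q - z)\<close>.
\<close>

lemma surface_factor_dvd:
  fixes h :: "'f alg_closure \<Rightarrow> 'r::idom"
  assumes R: "frobenius_ring TYPE('r) q" and h: "ring_map h"
    and y: "frob q 2 y - y = z ^ r" and b: "frob q 2 b - b = c ^ r"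
  shows "poly (map_poly h (Z ^ q + Z)) (c * z) - (frob q 1 y - b) * (y - frob q 1 b)
    dvd (frob q n z - c) * (frob q n c - z)"
proof -
  interpret frobenius_ring q "TYPE('r)" by (rule R)
  let ?t = "c * z" and ?h = "\<lambda>a. h (to_ac a)"
  define w where "w = poly (map_poly h (Z ^ q + Z)) ?t"
  define w0 where "w0 = (frob q 1 y - b) * (y - frob q 1 b)"
  define G where "G u = subst2 ?h F (?t ^ r + u + u ^ q) (u ^ (q + 1))" for u
  have h': "ring_map ?h" by (rule ring_map_comp[OF h ring_map_to_ac])
  have t: "?t ^ r = (frob q 2 b - b) * (frob q 2 y - y)"
    by (simp add: y b power_mult_distrib)
  have 1: "w * G w = frob q n ?t - ?t ^ r - frob q 1 (?t ^ r) + ?t"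
    using gk_Z_identity_eval[OF Z_identity odd_n h, of ?t] gk_Z_rhs_expand[OF odd_n, of ?t]
    unfolding G_def w_def by simp
  have 2: "w0 * G w0 = (frob q 1 (z ^ r) - c ^ r) * (z ^ r - frob q 1 (c ^ r))"
    using expected_w_identity[OF F_identity h' t] by (simp add: G_def w0_def y b)
  obtain s where s: "G w - G w0 = (w - w0) * s"
    using dvd_F_difference[OF h', where w = w and w' = w0 and t = ?t and r = r and F = F] unfolding G_def by (elim dvdE)
  have "(frob q n z - c) * (frob q n c - z) = w * G w - w0 * G w0"
    unfolding 1 2 using power_r_Frobenius[OF odd_n, of z] power_r_Frobenius[OF odd_n, of c]
    by (simp add: power_mult_distrib algebra_simps)
  also have "\<dots> = (w - w0) * G w + w0 * (G w - G w0)"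
    by (simp add: algebra_simps)
  also have "\<dots> = (w - w0) * (G w + w0 * s)"
    unfolding s by (simp add: algebra_simps)
  finally show ?thesis unfolding w_def w0_def by simp
qed

text \<open>
  Here \<open>\<xi>\<close> plays the role of \<open>y\<close> and \<open>g\<close> that of \<open>z^r\<close>, so that \<open>g^(q+1)\<close> is \<open>t = z^(Q+1)\<close>.  Both
  sides solve the equation that the identity for \<open>Z\<close> imposes on \<open>w\<close>.  Two solutions \<open>w\<close> and \<open>w\<^sub>0\<close>
  satisfy \<open>(w - w\<^sub>0) D = 0\<close>, and \<open>D\<close> takes the value \<open>F(0,0) = 1\<close> at \<open>\<xi> = 0\<close> if both solutions
  vanish there.
\<close>

lemma w_composition:
  fixes \<xi> :: "'f alg_closure poly"
  defines "\<xi> \<equiv> [:0, 1:]"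
  defines "g \<equiv> frob q 2 \<xi> - \<xi>"
  shows "pcompose (Z ^ q + Z) (g * frob q 1 g) = (frob q (n + 1) \<xi> - \<xi>) * (frob q n \<xi> - frob q 1 \<xi>)"
proof -
  let ?h = "\<lambda>a. [:to_ac a:] :: 'f alg_closure poly" and ?t = "g * frob q 1 g"
  define w where "w = pcompose (Z ^ q + Z) ?t"
  define w0 where "w0 = (frob q 1 \<xi> - frob q n \<xi>) * (\<xi> - frob q 1 (frob q n \<xi>))"
  define G where "G u = subst2 ?h F (?t ^ r + u + u ^ q) (u ^ (q + 1))" for u
  have h': "ring_map ?h" by (rule ring_map_comp[OF ring_map_const_poly ring_map_to_ac])
  have t: "?t ^ r = (frob q 2 (frob q n \<xi>) - frob q n \<xi>) * (frob q 2 \<xi> - \<xi>)"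
  proof -
    have "?t ^ r = g ^ (r * (q + 1))"
      by (simp add: frob_def power_mult_distrib power_add flip: power_mult) (simp add: mult.commute)
    also have "\<dots> = g * frob q n g"
      unfolding gk_r_times[OF odd_n] by (simp add: frob_def)
    finally show ?thesis by (simp add: g_def algebra_simps)
  qed
  have 1: "w * G w = frob q n ?t - ?t ^ r - frob q 1 (?t ^ r) + ?t"
    using gk_Z_identity_eval[OF Z_identity odd_n ring_map_const_poly, of ?t] K_poly.gk_Z_rhs_expand[OF odd_n, of ?t]
    unfolding G_def w_def pcompose_altdef by simp
  have 2: "w0 * G w0 = (frob q 1 g - frob q n g) * (g - frob q 1 (frob q n g))"
    using K_poly.expected_w_identity[OF F_identity h' t]
    by (simp add: G_def w0_def) (simp add: g_def add.commute)
  obtain s where s: "G w - G w0 = (w - w0) * s"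
    using K_poly.dvd_F_difference[OF h', where w = w and w' = w0 and t = ?t and r = r and F = F] unfolding G_def by (elim dvdE)
  have "w * G w = w0 * G w0"
    unfolding 1 2 t by (simp add: g_def algebra_simps)
  hence "(w - w0) * G w + w0 * (G w - G w0) = 0"
    by (simp add: algebra_simps)
  hence "(w - w0) * (G w + w0 * s) = 0"
    unfolding s by (simp add: algebra_simps)
  \<comment> \<open>At \<open>\<xi> = 0\<close> the elements \<open>g\<close>, \<open>w\<close> and \<open>w0\<close> vanish; for \<open>w\<close> this is where \<open>Z(0) = 0\<close> is used.\<close>
  moreover have "poly (G w + w0 * s) 0 = 1"
  proof -
    have zero: "poly (frob q i \<xi>) 0 = 0" "poly \<xi> 0 = 0" for i
      using K.q_gt_1 by (simp_all add: \<xi>_def frob_def)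
    have g0: "poly g 0 = 0" by (simp add: g_def zero)
    have w0: "poly w 0 = 0" "poly w0 0 = 0"
      using K.q_gt_1 by (simp_all add: w_def w0_def zero poly_pcompose g0 Z_0 del: K_poly.frob_frob)
    have "poly (G w) 0 = subst2 to_ac F (0 + 0) (0 * 0)"
      unfolding G_def subst2_ring_map[OF ring_map_poly h'] using K.q_gt_1 gk_r_pos[OF odd_n, of q]
      by (simp add: w0 g0 power_0_left)
    also have "\<dots> = 1"
      unfolding gk_F_identity_eval[OF F_identity ring_map_to_ac] using K.q_gt_1 by (simp add: power_0_left)
    finally show ?thesis by (simp add: w0)
  qed
  hence "G w + w0 * s \<noteq> 0" by (metis poly_0 zero_neq_one)
  ultimately have "w = w0" by simp
  thus ?thesis by (simp add: w_def w0_def algebra_simps)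
qed

text \<open>
  Let \<open>p\<close> be the difference of the two sides, written as a polynomial in \<open>y\<close>.  Then \<open>p^q + p = 0\<close> by
  the formula for \<open>w\<close>, so \<open>p\<close> has degree 0; and \<open>p\<close> vanishes at \<open>y = 0\<close>.  Since \<open>p = 0\<close> is an
  identity of polynomials, it holds at points with coordinates in any extension ring.
\<close>

lemma Z_on_curve:
  fixes h :: "'f alg_closure \<Rightarrow> 'r::idom"
  assumes R: "frobenius_ring TYPE('r) q" and h: "ring_map h"
    and x: "frob q 1 x + x = y * frob q 1 y" and y: "frob q 2 y - y = z ^ r"
  shows "x + frob q n x = y * frob q n y + poly (map_poly h Z) (z * frob q n z)"
proof -
  interpret frobenius_ring q "TYPE('r)" by (rule R)
  define \<xi> where "\<xi> = [:0, 1 :: 'f alg_closure:]"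
  define g where "g = frob q 2 \<xi> - \<xi>"
  define N where "N = \<xi> * frob q 1 \<xi>"
  define A where "A = (\<Sum>i<n. (-1) ^ i * frob q i N)"
  define p where "p = A - \<xi> * frob q n \<xi> - pcompose Z (g * frob q 1 g)"
  have "A + frob q 1 A = (\<Sum>i<n. (-1) ^ i * frob q i (N + frob q 1 N))"
    by (simp add: A_def ring_map_sum[OF K_poly.ring_map_frob] sum.distrib algebra_simps)
  also have "\<dots> = N + frob q n N"
    by (rule K_poly.frob_alternating_sum[OF odd_n])
  finally have A: "A + frob q 1 A = N + frob q n N" .
  have "pcompose (Z ^ k) u = pcompose Z u ^ k" for k u
    by (induction k) (simp_all add: pcompose_1 pcompose_mult)
  hence comp: "pcompose (Z ^ q + Z) u = frob q 1 (pcompose Z u) + pcompose Z u" for u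
    by (simp add: pcompose_add frob_def)
  have "p + frob q 1 p = (A + frob q 1 A) - (\<xi> * frob q n \<xi> + frob q 1 \<xi> * frob q (n + 1) \<xi>)
     - pcompose (Z ^ q + Z) (g * frob q 1 g)"
    by (simp add: p_def comp)
  also have "\<dots> = 0"
    unfolding A w_composition[folded \<xi>_def, folded g_def] by (simp add: N_def algebra_simps)
  finally have "p ^ q = - p"
    by (simp add: frob_def add_eq_0_iff)
  hence "degree (p ^ q) = degree p" by simp
  hence "degree p = 0"
    using K.q_gt_1 by (cases "p = 0") (simp_all add: degree_power_eq)
  moreover have "poly p 0 = 0"
  proof -
    have "poly (frob q i \<xi>) 0 = 0" "poly \<xi> 0 = 0" for i
      using K.q_gt_1 by (simp_all add: \<xi>_def frob_def)
    thus ?thesis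
      using Z_0 by (simp add: p_def A_def N_def g_def poly_sum poly_pcompose)
  qed
  ultimately have "p = 0" by (metis degree_0_id poly_pCons degree_eq_zeroE mult_zero_left add.right_neutral pCons_0_0)
  define \<Phi> where "\<Phi> u = poly (map_poly h u) y" for u
  have \<Phi>: "ring_map \<Phi>"
    unfolding \<Phi>_def by (rule ring_map_comp[OF ring_map_poly ring_map_map_poly[OF h]])
  note \<Phi>_simps = ring_map_simps[OF \<Phi>]
  have \<Phi>\<xi>: "\<Phi> \<xi> = y" and \<Phi>c: "\<Phi> [:a:] = h a" for a
    by (simp_all add: \<Phi>_def \<xi>_def map_poly_pCons_ring_map[OF h] ring_map_simps[OF h])
  have \<Phi>frob: "\<Phi> (frob q i u) = frob q i (\<Phi> u)" for i u
    by (simp add: frob_def \<Phi>_simps)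
  have "\<Phi> (pcompose Z (g * frob q 1 g)) = poly (map_poly h Z) (z * frob q n z)"
  proof -
    have "\<Phi> (pcompose Z u) = poly (map_poly h Z) (\<Phi> u)" for u
      unfolding pcompose_altdef ring_map_poly_map_poly[OF \<Phi> ring_map_const_poly] \<Phi>c ..
    moreover have "\<Phi> (g * frob q 1 g) = z * frob q n z"
      using power_r_Frobenius[OF odd_n, of z] unfolding y[symmetric]
      by (simp add: g_def \<Phi>_simps \<Phi>frob \<Phi>\<xi> del: frob_simps K_poly.frob_simps)
    ultimately show ?thesis by simp
  qed
  moreover have "\<Phi> A = x + frob q n x"
  proof -
    have "\<Phi> A = (\<Sum>i<n. (-1) ^ i * frob q i (x + frob q 1 x))"
      unfolding x[unfolded add.commute[of _ x]]
      by (simp add: A_def N_def ring_map_sum[OF \<Phi>] \<Phi>_simps \<Phi>frob \<Phi>\<xi> del: frob_simps K_poly.frob_simps)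
    thus ?thesis
      unfolding frob_alternating_sum[OF odd_n] .
  qed
  moreover have "\<Phi> p = 0" using \<open>p = 0\<close> by (simp add: \<Phi>_simps)
  ultimately show ?thesis
    by (simp add: p_def \<Phi>_simps \<Phi>frob \<Phi>\<xi> algebra_simps del: K_poly.frob_simps)
qed

text \<open>
  Differentiate the formula for \<open>w\<close>: all \<open>q\<close>-th powers have derivative 0, so \<open>w' = Z'\<close>, and
  \<open>g^(q+1)\<close> has derivative \<open>-g^q\<close>.
\<close>

lemma pderiv_Z_on_curve:
  fixes \<beta> :: "'f alg_closure"
  defines "g \<equiv> frob q 2 \<beta> - \<beta>"
  shows "poly (pderiv Z) (g * frob q 1 g) * frob q 1 g = frob q n \<beta> - frob q 1 \<beta>"
proof -
  define \<xi> where "\<xi> = [:0, 1 :: 'f alg_closure:]"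
  define G where "G = frob q 2 \<xi> - \<xi>"
  have n: "n \<noteq> 0" using odd_n by (metis even_zero)
  have D: "pderiv (frob q i p) = 0" if "i \<noteq> 0" for i and p :: "'f alg_closure poly"
    using that by (simp add: frob_def pderiv_power of_nat_q)
  have \<xi>: "pderiv \<xi> = 1" by (simp add: \<xi>_def pderiv_pCons)
  have G: "pderiv G = -1" by (simp add: G_def pderiv_diff D \<xi>)
  have Z: "pderiv (Z ^ q + Z) = pderiv Z"
    using D[of 1 Z] by (simp add: pderiv_add frob_def)
  have "pderiv (pcompose (Z ^ q + Z) (G * frob q 1 G)) = pderiv ((frob q (n + 1) \<xi> - \<xi>) * (frob q n \<xi> - frob q 1 \<xi>))"
    unfolding w_composition[folded \<xi>_def, folded G_def] ..
  hence "pcompose (pderiv Z) (G * frob q 1 G) * (- frob q 1 G) = - (frob q n \<xi> - frob q 1 \<xi>)"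
    unfolding pderiv_pcompose Z by (simp add: pderiv_mult D n pderiv_diff G \<xi>)
  hence "poly (pcompose (pderiv Z) (G * frob q 1 G) * (- frob q 1 G)) \<beta> = poly (- (frob q n \<xi> - frob q 1 \<xi>)) \<beta>"
    by (rule arg_cong)
  moreover have "poly (frob q i p) \<beta> = frob q i (poly p \<beta>)" for i p
    by (simp add: frob_def)
  ultimately show ?thesis
    by (simp add: poly_pcompose G_def \<xi>_def g_def algebra_simps del: K_poly.frob_simps)
qed

section \<open>Zeros of the surface on the curve\<close>

text \<open>
  The function \<open>f\<close> divides \<open>f^q + f\<close>, which is \<open>w\<^sub>0 - w\<close> by the first equation of the curve.
\<close>

lemma surface_dvd:
  fixes h :: "'f alg_closure \<Rightarrow> 'r::idom"
  assumes R: "frobenius_ring TYPE('r) q" and h: "ring_map h"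
    and x: "frob q 1 x + x = y * frob q 1 y" and y: "frob q 2 y - y = z ^ r"
    and a: "frob q 1 a + a = b * frob q 1 b" and b: "frob q 2 b - b = c ^ r"
  shows "x + a - b * y - poly (map_poly h Z) (c * z) dvd (frob q n z - c) * (frob q n c - z)"
proof -
  interpret frobenius_ring q "TYPE('r)" by (rule R)
  define f where "f = x + a - b * y - poly (map_poly h Z) (c * z)"
  define w where "w = poly (map_poly h (Z ^ q + Z)) (c * z)"
  have w: "w = frob q 1 (poly (map_poly h Z) (c * z)) + poly (map_poly h Z) (c * z)"
    by (simp add: w_def ring_map_simps[OF ring_map_map_poly[OF h]] frob_def)
  have "frob q 1 f + f = (frob q 1 x + x) + (frob q 1 a + a) - (frob q 1 b * frob q 1 y + b * y) - w"
    by (simp add: f_def w)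
  also have "\<dots> = - (w - (frob q 1 y - b) * (y - frob q 1 b))"
    unfolding x a by (simp add: algebra_simps)
  finally have "w - (frob q 1 y - b) * (y - frob q 1 b) = - (frob q 1 f + f)" by simp
  moreover have "f dvd frob q 1 f + f"
    using q_gt_1 by (auto simp: frob_def intro!: dvd_add dvd_power)
  ultimately have "f dvd w - (frob q 1 y - b) * (y - frob q 1 b)" by simp
  thus ?thesis
    using surface_factor_dvd[OF R h y b] unfolding f_def w_def by (rule dvd_trans)
qed

text \<open>
  The two differences \<open>m = \<beta>^(qQ) - \<beta>\<close> and \<open>k = \<beta>^q - \<beta>^Q\<close> are the factors of \<open>w\<close> up to sign.
  They determine \<open>\<gamma>^r\<close>, its \<open>Q\<close>-th power and \<open>\<beta>^(Q^2) - \<beta>\<close>, and all later computations at \<open>P\<close>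
  take place between them.
\<close>

lemma frob_differences:
  fixes \<beta> :: "'f alg_closure"
  assumes "frob q 2 \<beta> - \<beta> = \<gamma> ^ r"
  defines "m \<equiv> frob q (n + 1) \<beta> - \<beta>" and "k \<equiv> frob q 1 \<beta> - frob q n \<beta>"
  shows "\<gamma> ^ r = m + frob q 1 k" "frob q n (\<gamma> ^ r) = k + frob q 1 m"
    "frob q (2 * n) \<beta> - \<beta> = m - frob q n k"
  unfolding assms(1)[symmetric] m_def k_def by (simp_all add: mult_2 numeral_2_eq_2)

lemma unit_norm_fixed:
  fixes \<mu> :: "'f alg_closure"
  assumes "\<mu> * frob q 1 \<mu> = 1"
  shows "frob q 2 \<mu> = \<mu>"
proof -
  have 1: "frob q 1 \<mu> * frob q 2 \<mu> = 1"
    using arg_cong[OF assms, of "frob q 1"] by (simp add: numeral_2_eq_2)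
  have "frob q 2 \<mu> = (\<mu> * frob q 1 \<mu>) * frob q 2 \<mu>"
    unfolding assms by simp
  also have "\<dots> = \<mu>"
    unfolding mult.assoc 1 by simp
  finally show ?thesis .
qed

text \<open>
  The eigenvalue \<open>\<mu>\<close> lies in the field of \<open>q^2\<close> elements, so the eigenvector equation passes from
  \<open>\<beta>^(q^2) - \<beta>\<close> to the sum \<open>\<beta>^(q^(2i)) - \<beta>\<close> of its conjugates; and \<open>k\<close> is minus the \<open>q\<close>-th power
  of such a sum because \<open>n\<close> is odd.
\<close>

lemma frob_eigenvector:
  fixes \<beta> \<mu> :: "'f alg_closure"
  assumes \<mu>: "\<mu> * frob q 1 \<mu> = 1" and g: "frob q n (frob q 2 \<beta> - \<beta>) = \<mu> * (frob q 2 \<beta> - \<beta>)"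
  defines "k \<equiv> frob q 1 \<beta> - frob q n \<beta>"
  shows "\<mu> * frob q n k = k"
proof -
  have fixed: "frob q (2 * i) \<mu> = \<mu>" for i
    by (rule K.frob_iterate_fixed[OF unit_norm_fixed[OF \<mu>]])
  have *: "frob q n (frob q (2 * i) \<beta> - \<beta>) = \<mu> * (frob q (2 * i) \<beta> - \<beta>)" for i
  proof (induction i)
    case (Suc i)
    have split: "frob q (2 * Suc i) \<beta> - \<beta> = frob q (2 * i) (frob q 2 \<beta> - \<beta>) + (frob q (2 * i) \<beta> - \<beta>)"
      by (simp add: add.commute)
    have "frob q n (frob q (2 * i) (frob q 2 \<beta> - \<beta>)) = frob q (2 * i) (frob q n (frob q 2 \<beta> - \<beta>))"
      by (simp add: add.commute add.left_commute)
    also have "\<dots> = \<mu> * frob q (2 * i) (frob q 2 \<beta> - \<beta>)"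
      unfolding g K.frob_simps(4) fixed ..
    finally have "frob q n (frob q (2 * i) (frob q 2 \<beta> - \<beta>)) = \<mu> * frob q (2 * i) (frob q 2 \<beta> - \<beta>)" .
    thus ?case
      unfolding split K.frob_simps(3) Suc.IH distrib_left by simp
  qed simp
  obtain j where j: "n = 2 * j + 1" using odd_n by (elim oddE)
  have k: "k = - frob q 1 (frob q (2 * j) \<beta> - \<beta>)" by (simp add: k_def j)
  have "frob q n k = - frob q 1 (frob q n (frob q (2 * j) \<beta> - \<beta>))"
    unfolding k by simp
  also have "\<dots> = frob q 1 \<mu> * k"
    unfolding * k by (simp add: algebra_simps)
  finally show ?thesis using \<mu> by (simp flip: mult.assoc)
qed

text \<open>
  The element \<open>\<gamma>^(Q+1) = \<gamma>^(r(q+1))\<close> is multiplied by \<open>\<mu>^(q+1) = 1\<close> under the \<open>Q\<close>-th power map.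
\<close>

lemma frob_eigenvector_fixed_point:
  fixes \<gamma> \<mu> :: "'f alg_closure"
  assumes \<mu>: "\<mu> * frob q 1 \<mu> = 1" and g: "frob q n (\<gamma> ^ r) = \<mu> * \<gamma> ^ r"
  shows "frob q (2 * n) \<gamma> = \<gamma>"
proof (cases "\<gamma> = 0")
  case False
  have "frob q n (\<gamma> * frob q n \<gamma>) = frob q n (\<gamma> ^ r * frob q 1 (\<gamma> ^ r))"
    unfolding K.power_r_Frobenius[OF odd_n] ..
  also have "\<dots> = frob q n (\<gamma> ^ r) * frob q 1 (frob q n (\<gamma> ^ r))"
    by (simp del: K.frob_simps(7))
  also have "\<dots> = (\<mu> * frob q 1 \<mu>) * (\<gamma> ^ r * frob q 1 (\<gamma> ^ r))"
    unfolding g by simp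
  also have "\<dots> = \<gamma> * frob q n \<gamma>"
    unfolding \<mu> K.power_r_Frobenius[OF odd_n] by simp
  finally have "frob q n \<gamma> * frob q (2 * n) \<gamma> = frob q n \<gamma> * \<gamma>"
    unfolding mult_2 by (simp add: mult.commute)
  moreover have "frob q n \<gamma> \<noteq> 0" using False by (simp add: frob_def)
  ultimately show ?thesis by simp
qed simp

text \<open>
  The last hypothesis says that \<open>f\<close> vanishes at a point with the same \<open>z\<close> as \<open>P\<close> and with
  \<open>y = \<beta> + u\<close>.  Together with its \<open>q\<close>-th power it makes \<open>\<gamma>^r\<close> an eigenvector of the \<open>Q\<close>-th power
  map for the eigenvalue \<open>u^(q-1)\<close>, and then the point can only be \<open>P'\<close>.
\<close>

lemma second_zero_in_fibre:
  fixes \<beta> \<gamma> u :: "'f alg_closure"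
  assumes g: "frob q 2 \<beta> - \<beta> = \<gamma> ^ r" and u: "frob q 2 u = u" "u \<noteq> 0"
    and eq: "frob q 1 u * (frob q (n + 1) \<beta> - \<beta>) = u * (frob q 1 \<beta> - frob q n \<beta>) + u * frob q 1 u"
  shows "frob q (2 * n) \<gamma> = \<gamma>" "frob q (2 * n) \<beta> = \<beta> + u"
proof -
  define m where "m = frob q (n + 1) \<beta> - \<beta>"
  define k where "k = frob q 1 \<beta> - frob q n \<beta>"
  define v where "v = frob q 1 u"
  define \<mu> where "\<mu> = v / u"
  note step = frob_differences[OF g, folded m_def k_def]
  have v0: "v \<noteq> 0" using u by (simp add: v_def frob_def)
  have v1: "frob q 1 v = u" using u(1) by (simp add: v_def numeral_2_eq_2)
  have \<mu>: "\<mu> * frob q 1 \<mu> = 1"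
    using u v0 v1 by (simp add: \<mu>_def frob_def power_divide v_def)
  have eq: "v * m = u * k + u * v" using eq by (simp add: v_def m_def k_def)
  have eq1: "u * frob q 1 m = v * frob q 1 k + u * v"
    using arg_cong[OF eq, of "frob q 1"]
    unfolding K.frob_simps(3,4) v1 v_def[symmetric] by (simp add: mult.commute)
  have "v * \<gamma> ^ r = u * frob q n (\<gamma> ^ r)"
    unfolding step(2) unfolding step(1) using eq eq1 by (simp add: algebra_simps)
  hence \<gamma>: "frob q n (\<gamma> ^ r) = \<mu> * \<gamma> ^ r"
    using u by (simp add: \<mu>_def field_simps)
  show "frob q (2 * n) \<gamma> = \<gamma>"
    by (rule frob_eigenvector_fixed_point[OF \<mu> \<gamma>])
  have "\<mu> * frob q n k = k"
    using frob_eigenvector[OF \<mu>, of \<beta>] \<gamma> unfolding g k_def by blast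
  hence "v * frob q n k = u * k"
    using u by (simp add: \<mu>_def field_simps)
  hence "v * (m - frob q n k) = v * u"
    using eq by (simp add: algebra_simps)
  hence "m - frob q n k = u" using v0 by simp
  thus "frob q (2 * n) \<beta> = \<beta> + u" using step(3) by (simp add: algebra_simps)
qed

section \<open>The coefficient that detects fixed points\<close>

text \<open>
  The coefficient of \<open>(z - \<gamma>)^Q\<close> in the expansion of \<open>f\<close> at \<open>P\<close>.
\<close>

definition \<kappa> :: "'f alg_closure \<Rightarrow> 'f alg_closure \<Rightarrow> 'f alg_closure" where
  "\<kappa> \<beta> \<gamma> = frob q n (\<gamma> ^ (r - 1)) * (frob q (n + 1) \<beta> - \<beta>) + \<gamma> * poly (pderiv Z) (\<gamma> * frob q n \<gamma>)"

text \<open>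
  Eliminating \<open>Z'\<close> by its value on the curve leaves a difference of two norms from the quadratic
  extension.
\<close>

lemma \<kappa>_norms:
  fixes \<beta> \<gamma> :: "'f alg_closure"
  assumes g: "frob q 2 \<beta> - \<beta> = \<gamma> ^ r"
  defines "m \<equiv> frob q (n + 1) \<beta> - \<beta>" and "k \<equiv> frob q 1 \<beta> - frob q n \<beta>"
  shows "frob q n \<gamma> * \<kappa> \<beta> \<gamma> = m * frob q 1 m - k * frob q 1 k"
proof -
  note step = frob_differences[OF g, folded m_def k_def]
  have "\<gamma> ^ r = \<gamma> * \<gamma> ^ (r - 1)"
    using gk_r_pos[OF odd_n, of q] by (cases r) simp_all
  hence 1: "frob q n \<gamma> * frob q n (\<gamma> ^ (r - 1)) = frob q n (\<gamma> ^ r)"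
    by (simp del: K.frob_simps(7))
  have "poly (pderiv Z) (\<gamma> * frob q n \<gamma>) * frob q 1 (\<gamma> ^ r) = - k"
    using pderiv_Z_on_curve[of \<beta>] unfolding g K.power_r_Frobenius[OF odd_n] by (simp add: k_def)
  hence "\<gamma> ^ r * (poly (pderiv Z) (\<gamma> * frob q n \<gamma>) * frob q 1 (\<gamma> ^ r)) = \<gamma> ^ r * (- k)" by simp
  hence 2: "\<gamma> * frob q n \<gamma> * poly (pderiv Z) (\<gamma> * frob q n \<gamma>) = - k * \<gamma> ^ r"
    unfolding K.power_r_Frobenius[OF odd_n, symmetric] by (simp only: ac_simps mult_minus_left mult_minus_right)
  have "frob q n \<gamma> * \<kappa> \<beta> \<gamma> = (frob q n \<gamma> * frob q n (\<gamma> ^ (r - 1))) * m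
      + \<gamma> * frob q n \<gamma> * poly (pderiv Z) (\<gamma> * frob q n \<gamma>)"
    by (simp add: \<kappa>_def m_def algebra_simps)
  also have "\<dots> = (k + frob q 1 m) * m - k * (m + frob q 1 k)"
    unfolding 1 2 step(2) unfolding step(1) by simp
  finally show ?thesis by (simp add: algebra_simps)
qed

text \<open>
  For \<open>\<gamma> \<noteq> 0\<close> the condition is that \<open>m\<close> and \<open>k\<close> have the same norm.  Then \<open>\<mu> = k / m\<close> has norm 1
  and is an eigenvalue of the \<open>Q\<close>-th power map with eigenvector \<open>\<gamma>^r\<close>, whence \<open>\<gamma>^(Q^2) = \<gamma>\<close> and
  \<open>\<beta>^(Q^2) - \<beta> = m - k^Q = 0\<close>.  Conversely, if \<open>P\<close> is fixed, the quotient of \<open>\<gamma>^(rQ)\<close> by \<open>\<gamma>^r\<close> has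
  norm 1, and multiplication by it takes \<open>m\<close> to \<open>k\<close>.
\<close>

lemma \<kappa>_eq_0_iff:
  fixes \<beta> \<gamma> :: "'f alg_closure"
  assumes g: "frob q 2 \<beta> - \<beta> = \<gamma> ^ r"
  shows "\<kappa> \<beta> \<gamma> = 0 \<longleftrightarrow> frob q (2 * n) \<gamma> = \<gamma> \<and> frob q (2 * n) \<beta> = \<beta>"
proof (cases "\<gamma> = 0")
  case True
  hence "frob q 2 \<beta> = \<beta>" using g gk_r_pos[OF odd_n, of q] by (simp add: power_0_left)
  hence fixed: "frob q (2 * i) \<beta> = \<beta>" for i by (rule K.frob_iterate_fixed)
  moreover obtain j where "n + 1 = 2 * j" using odd_n by (metis evenE odd_add odd_one)
  ultimately have "frob q (n + 1) \<beta> = \<beta>" by simp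
  thus ?thesis using True fixed by (simp add: \<kappa>_def)
next
  case False
  define m where "m = frob q (n + 1) \<beta> - \<beta>"
  define k where "k = frob q 1 \<beta> - frob q n \<beta>"
  note step = frob_differences[OF g, folded m_def k_def]
  have frob0: "frob q i c = 0 \<longleftrightarrow> c = 0" for i and c :: "'f alg_closure"
    using K.q_gt_1 by (simp add: frob_def)
  have \<kappa>0: "\<kappa> \<beta> \<gamma> = 0 \<longleftrightarrow> m * frob q 1 m = k * frob q 1 k"
    using \<kappa>_norms[OF g, folded m_def k_def] False frob0[of n \<gamma>]
    by (metis eq_iff_diff_eq_0 mult_eq_0_iff)
  have g0: "\<gamma> ^ r \<noteq> 0" using False by simp
  show ?thesis
  proof
    assume "\<kappa> \<beta> \<gamma> = 0"
    hence norms: "m * frob q 1 m = k * frob q 1 k" using \<kappa>0 by simp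
    have m0: "m \<noteq> 0" and k0: "k \<noteq> 0"
      using g0 norms unfolding step(1) by (auto simp: frob0)
    define \<mu> where "\<mu> = k / m"
    have "frob q 1 (k / m) = frob q 1 k / frob q 1 m" by (simp add: frob_def power_divide)
    hence "\<mu> * frob q 1 \<mu> = (k * frob q 1 k) / (m * frob q 1 m)"
      by (simp only: \<mu>_def times_divide_times_eq)
    hence \<mu>: "\<mu> * frob q 1 \<mu> = 1"
      using m0 frob0[of 1 m] by (simp only: norms[symmetric] divide_self mult_eq_0_iff simp_thms)
    have "\<mu> * (m + frob q 1 k) = (k * m + k * frob q 1 k) / m"
      by (simp add: \<mu>_def distrib_left)
    also have "\<dots> = k + frob q 1 m"
      unfolding norms[symmetric] using m0 by (simp add: add_divide_distrib)
    finally have \<gamma>: "frob q n (\<gamma> ^ r) = \<mu> * \<gamma> ^ r"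
      unfolding step(2) unfolding step(1) by simp
    have "\<mu> * frob q n k = k"
      using frob_eigenvector[OF \<mu>, of \<beta>] \<gamma> unfolding g k_def by blast
    hence "frob q n k = m" using m0 k0 by (simp add: \<mu>_def field_simps)
    thus "frob q (2 * n) \<gamma> = \<gamma> \<and> frob q (2 * n) \<beta> = \<beta>"
      using frob_eigenvector_fixed_point[OF \<mu> \<gamma>] step(3) by simp
  next
    assume fixed: "frob q (2 * n) \<gamma> = \<gamma> \<and> frob q (2 * n) \<beta> = \<beta>"
    define \<mu> where "\<mu> = frob q n (\<gamma> ^ r) / \<gamma> ^ r"
    have \<gamma>: "frob q n (\<gamma> ^ r) = \<mu> * \<gamma> ^ r" using g0 by (simp add: \<mu>_def del: K.frob_simps(7))
    have "frob q n (\<gamma> ^ r) * frob q 1 (frob q n (\<gamma> ^ r)) = frob q n (\<gamma> * frob q n \<gamma>)"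
      unfolding K.power_r_Frobenius[OF odd_n, symmetric] by (simp del: K.frob_simps(7))
    also have "\<dots> = \<gamma> ^ r * frob q 1 (\<gamma> ^ r)"
      using fixed unfolding K.power_r_Frobenius[OF odd_n] by (simp add: mult_2)
    finally have "(\<mu> * frob q 1 \<mu>) * (\<gamma> ^ r * frob q 1 (\<gamma> ^ r)) = 1 * (\<gamma> ^ r * frob q 1 (\<gamma> ^ r))"
      unfolding \<gamma> by (simp add: algebra_simps)
    hence \<mu>: "\<mu> * frob q 1 \<mu> = 1"
      using False frob0 by (metis g0 mult_cancel_right no_zero_divisors)
    have "\<mu> * frob q n k = k"
      using frob_eigenvector[OF \<mu>, of \<beta>] \<gamma> unfolding g k_def by blast
    hence "k = \<mu> * m" using step(3) fixed by simp
    hence "k * frob q 1 k = (\<mu> * frob q 1 \<mu>) * (m * frob q 1 m)" by simp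
    thus "\<kappa> \<beta> \<gamma> = 0" using \<kappa>0 \<mu> by simp
  qed
qed

section \<open>The support of the divisor\<close>

text \<open>
  Both points are zeros by the identity for \<open>Z\<close> at \<open>P\<close> and at \<open>P^Q\<close>.  A further zero lies over
  \<open>z = \<gamma>\<close> or \<open>z = \<gamma>^(Q^2)\<close>.  Over either value the zero is compared with the known one: the
  difference \<open>u\<close> of the \<open>y\<close>-coordinates lies in the field of \<open>q^2\<close> elements, and \<open>x\<close> is determined by
  \<open>y\<close> and \<open>z\<close>.
\<close>

lemma surface_zeros:
  fixes x y z \<alpha> \<beta> \<gamma> :: "'f alg_closure"
  assumes x: "frob q 1 x + x = y * frob q 1 y" and y: "frob q 2 y - y = z ^ r"
    and \<alpha>: "frob q 1 \<alpha> + \<alpha> = \<beta> * frob q 1 \<beta>" and \<beta>: "frob q 2 \<beta> - \<beta> = \<gamma> ^ r"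
  shows "x + frob q n \<alpha> - frob q n \<beta> * y - poly Z (frob q n \<gamma> * z) = 0 \<longleftrightarrow>
    (x, y, z) = (\<alpha>, \<beta>, \<gamma>) \<or> (x, y, z) = (frob q (2 * n) \<alpha>, frob q (2 * n) \<beta>, frob q (2 * n) \<gamma>)"
proof -
  define f where "f x y z = x + frob q n \<alpha> - frob q n \<beta> * y - poly Z (frob q n \<gamma> * z)" for x y z
  define a1 where "a1 = frob q (2 * n) \<alpha>"
  define b1 where "b1 = frob q (2 * n) \<beta>"
  define c1 where "c1 = frob q (2 * n) \<gamma>"
  have frob_curve: "frob q 1 (frob q i \<alpha>) + frob q i \<alpha> = frob q i \<beta> * frob q 1 (frob q i \<beta>)"
    "frob q 2 (frob q i \<beta>) - frob q i \<beta> = frob q i \<gamma> ^ r" for i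
    using arg_cong[OF \<alpha>, of "frob q i"] arg_cong[OF \<beta>, of "frob q i"] by (simp_all add: add.commute)
  have id: "map_poly (\<lambda>x. x) Z = Z" by simp
  have on: "s + frob q n s = t * frob q n t + poly Z (v * frob q n v)"
    if "frob q 1 s + s = t * frob q 1 t" "frob q 2 t - t = v ^ r" for s t v :: "'f alg_closure"
    using Z_on_curve[OF K.frobenius_ring_axioms ring_map_id that] by simp
  have fP: "f \<alpha> \<beta> \<gamma> = 0"
    using on[OF \<alpha> \<beta>] by (simp add: f_def algebra_simps)
  have fP': "f a1 b1 c1 = 0"
    using on[OF frob_curve(1,2)[of n]] unfolding f_def a1_def b1_def c1_def mult_2 by (simp add: algebra_simps)
  have difference: "frob q 1 u * (frob q (n + 1) \<beta> - b) = u * (frob q 1 b - frob q n \<beta>) + u * frob q 1 u"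
    if "f x y z = 0" "f a b z = 0" "frob q 1 a + a = b * frob q 1 b" "u = y - b" for a b u
  proof -
    have yb: "y = b + u" using that(4) by simp
    have "f x y z - f a b z = 0" using that(1,2) by simp
    hence xa: "x = a + frob q n \<beta> * u" unfolding f_def yb by (simp add: algebra_simps)
    have "(frob q 1 a + a) + (frob q (n + 1) \<beta> * frob q 1 u + frob q n \<beta> * u) = (b + u) * frob q 1 (b + u)"
      using x unfolding xa yb by (simp add: algebra_simps)
    thus ?thesis unfolding that(3) by (simp add: algebra_simps)
  qed
  have main: "(x, y, z) = (\<alpha>, \<beta>, \<gamma>) \<or> (x, y, z) = (a1, b1, c1)" if f0: "f x y z = 0"
  proof -
    have same: "x = s" if "f s y z = 0" for s
      using f0 that unfolding f_def by (metis add_right_cancel diff_add_cancel)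
    have "(frob q n z - frob q n \<gamma>) * (frob q n (frob q n \<gamma>) - z) = 0"
      using surface_dvd[OF K.frobenius_ring_axioms ring_map_id x y frob_curve[of n]] f0
      by (simp add: f_def)
    hence "z = \<gamma> \<or> z = c1" by (auto simp: c1_def mult_2)
    thus ?thesis
    proof
      assume z: "z = \<gamma>"
      define u where "u = y - \<beta>"
      have u2: "frob q 2 u = u" using y \<beta> by (simp add: u_def z algebra_simps)
      have eq: "frob q 1 u * (frob q (n + 1) \<beta> - \<beta>) = u * (frob q 1 \<beta> - frob q n \<beta>) + u * frob q 1 u"
        by (rule difference[OF f0 _ \<alpha> u_def]) (use fP z in simp)
      show ?thesis
      proof (cases "u = 0")
        case True
        thus ?thesis using same[of \<alpha>] fP z by (simp add: u_def)
      next
        case False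
        hence "frob q (2 * n) \<gamma> = \<gamma>" "frob q (2 * n) \<beta> = y"
          using second_zero_in_fibre[OF \<beta> u2 False eq] by (simp_all add: u_def)
        thus ?thesis using same[of a1] fP' z by (simp add: b1_def c1_def)
      qed
    next
      assume z: "z = c1"
      define u where "u = y - b1"
      \<comment> \<open>Over this value of \<open>z\<close> the zero is compared with \<open>P'\<close>.\<close>
      have b1_curve: "frob q 2 b1 - b1 = c1 ^ r" "frob q 1 a1 + a1 = b1 * frob q 1 b1"
        unfolding a1_def b1_def c1_def by (rule frob_curve)+
      have u2: "frob q 2 u = u" using y b1_curve(1) by (simp add: u_def z algebra_simps)
      have eq: "frob q 1 u * (frob q (n + 1) \<beta> - b1) = u * (frob q 1 b1 - frob q n \<beta>) + u * frob q 1 u"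
        by (rule difference[OF f0 _ b1_curve(2) u_def]) (use fP' z in simp)
      show ?thesis
      proof (cases "u = 0")
        case True
        thus ?thesis using same[of a1] fP' z by (simp add: u_def)
      next
        case False
        define B where "B = frob q n \<beta>"
        \<comment> \<open>With \<open>P^Q\<close> in place of \<open>P\<close> and \<open>-u^q\<close> in place of \<open>u\<close>, the relation for \<open>u\<close> takes the
          shape of the fibre over \<open>\<gamma>\<close>.\<close>
        define v where "v = - frob q 1 u"
        have v1: "frob q 1 v = - u" using u2 by (simp add: v_def numeral_2_eq_2)
        have v2: "frob q 2 v = v" using arg_cong[OF u2, of "frob q 1"] by (simp add: v_def numeral_3_eq_3)
        have v0: "v \<noteq> 0" using False by (simp add: v_def frob_def)
        have "frob q 1 v * (frob q (n + 1) B - B) = v * (frob q 1 B - frob q n B) + v * frob q 1 v"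
          unfolding v1 using eq unfolding v_def B_def b1_def mult_2 by (simp add: algebra_simps)
        from second_zero_in_fibre[OF frob_curve(2)[of n, folded B_def] v2 v0 this]
        have "frob q n (frob q (2 * n) \<gamma>) = frob q n \<gamma>"
          and \<beta>1: "frob q n (frob q (2 * n) \<beta>) = frob q n \<beta> - frob q 1 u"
          by (simp_all add: B_def v_def add.commute)
        hence c1: "c1 = \<gamma>" unfolding c1_def by (simp only: K.frob_eq_iff)
        obtain j where j: "n = 2 * j + 1" using odd_n by (elim oddE)
        have "frob q n u = frob q 1 (frob q (2 * j) u)" by (simp add: j)
        hence "frob q n u = frob q 1 u" using K.frob_iterate_fixed[OF u2] by simp
        hence "frob q n b1 = frob q n (\<beta> - u)" using \<beta>1 by (simp add: b1_def)
        hence "b1 = \<beta> - u" by (simp only: K.frob_eq_iff)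
        hence "y = \<beta>" by (simp add: u_def)
        thus ?thesis using same[of \<alpha>] fP z c1 by simp
      qed
    qed
  qed
  show ?thesis
    using main fP fP' unfolding f_def[symmetric] a1_def[symmetric] b1_def[symmetric] c1_def[symmetric] by auto
qed

end

section \<open>Ideals\<close>

lemma module_mult: "Modules.module ((*) :: 'r::comm_ring_1 \<Rightarrow> 'r \<Rightarrow> 'r)"
  by unfold_locales (simp_all add: algebra_simps)

lemma ideal_gen_base: "a \<in> S \<Longrightarrow> a \<in> ideal_gen S"
  unfolding ideal_gen_def by (rule Modules.module.span_base[OF module_mult])

lemma ideal_gen_0: "0 \<in> ideal_gen S"
  unfolding ideal_gen_def by (rule Modules.module.span_zero[OF module_mult])

lemma ideal_gen_add: "a \<in> ideal_gen S \<Longrightarrow> b \<in> ideal_gen S \<Longrightarrow> a + b \<in> ideal_gen S"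
  unfolding ideal_gen_def by (rule Modules.module.span_add[OF module_mult])

lemma ideal_gen_mult: "a \<in> ideal_gen S \<Longrightarrow> c * a \<in> ideal_gen S"
  unfolding ideal_gen_def by (rule Modules.module.span_scale[OF module_mult])

lemma ring_map_dvd_ideal_gen:
  assumes h: "ring_map h" and S: "\<And>g. g \<in> S \<Longrightarrow> d dvd h g" and g: "g \<in> ideal_gen S"
  shows "d dvd h g"
proof -
  note h = ring_map_simps[OF h]
  have "Modules.module.subspace (*) {g. d dvd h g}"
    unfolding Modules.module.subspace_def[OF module_mult] by (auto simp: h)
  hence "ideal_gen S \<subseteq> {g. d dvd h g}"
    unfolding ideal_gen_def using S by (intro Modules.module.span_minimal[OF module_mult]) auto
  thus ?thesis using g by auto
qed

section \<open>Points with coordinates in an extension ring\<close>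

definition eval_at :: "('k::comm_ring_1 \<Rightarrow> 'r::comm_ring_1) \<Rightarrow> 'r point \<Rightarrow> 'k poly3 \<Rightarrow> 'r" where
  "eval_at h P f = eval3 (map_poly (map_poly (map_poly h)) f) P"

lemma ring_map_eval3: "ring_map (\<lambda>f. eval3 f P)"
  by (cases P) (simp add: eval3_def ring_map_def)

lemma ring_map_eval_at: "ring_map h \<Longrightarrow> ring_map (eval_at h P)"
  unfolding eval_at_def by (intro ring_map_comp[OF ring_map_eval3] ring_map_map_poly)

lemma eval_at_simps:
  assumes "ring_map h"
  shows "eval_at h (x, y, z) (Const3 a) = h a" "eval_at h (x, y, z) X3 = x"
    "eval_at h (x, y, z) Y3 = y" "eval_at h (x, y, z) Z3 = z"
proof -
  note h1 = assms and h2 = ring_map_map_poly[OF assms]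
  note h3 = ring_map_map_poly[OF h2]
  show "eval_at h (x, y, z) (Const3 a) = h a" "eval_at h (x, y, z) X3 = x"
    "eval_at h (x, y, z) Y3 = y" "eval_at h (x, y, z) Z3 = z"
    by (simp_all add: eval_at_def eval3_def Const3_def X3_def Y3_def Z3_def
        map_poly_pCons_ring_map[OF h1] map_poly_pCons_ring_map[OF h2] map_poly_pCons_ring_map[OF h3]
        ring_map_simps[OF h1] ring_map_simps[OF h2] ring_map_simps[OF h3])
qed

lemma eval3_eq_eval_at: "eval3 f P = eval_at (\<lambda>x. x) P f"
proof -
  have "map_poly (map_poly (map_poly (\<lambda>x. x))) f = f"
    by (intro poly_eqI) (simp add: coeff_map_poly)
  thus ?thesis by (simp add: eval_at_def)
qed

lemma eval_at_comp:
  assumes g: "ring_map g" and h: "ring_map h"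
  shows "g (eval_at h (x, y, z) f) = eval_at (\<lambda>a. g (h a)) (g x, g y, g z) f"
proof -
  note g2 = ring_map_map_poly[OF g]
  note g3 = ring_map_map_poly[OF g2]
  have map: "map_poly (map_poly (map_poly (\<lambda>a. g (h a)))) f =
      map_poly (map_poly (map_poly g)) (map_poly (map_poly (map_poly h)) f)"
    by (intro poly_eqI) (simp add: coeff_map_poly ring_map_simps[OF g] ring_map_simps[OF h])
  have "g (eval3 F (x, y, z)) = eval3 (map_poly (map_poly (map_poly g)) F) (g x, g y, g z)" for F
  proof -
    have c: "[:[:g z:]:] = map_poly (map_poly g) [:[:z:]:]" "[:g y:] = map_poly g [:y:]"
      by (simp_all add: map_poly_pCons_ring_map[OF g] map_poly_pCons_ring_map[OF g2])
    show ?thesis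
      unfolding eval3_def prod.case c poly_map_poly_ring_map[OF g3] poly_map_poly_ring_map[OF g2]
        poly_map_poly_ring_map[OF g] ..
  qed
  thus ?thesis by (simp add: eval_at_def map)
qed

lemma eval_at_fps_nth_0:
  "fps_nth (eval_at fps_const (x, y, z) f) 0 = eval3 f (fps_nth x 0, fps_nth y 0, fps_nth z 0)"
  using eval_at_comp[OF ring_map_fps_nth_0 ring_map_fps_const, of x y z f]
  by (simp add: eval3_eq_eval_at)

lemma ring_map_Const3: "ring_map Const3"
  by (simp add: ring_map_def Const3_def one_pCons)

text \<open>
  Divide with remainder by the three linear polynomials, one variable after the other.
\<close>

lemma max_ideal_at_decompose:
  fixes f :: "'k::comm_ring_1 poly3"
  assumes "eval3 f (\<alpha>, \<beta>, \<gamma>) = 0"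
  shows "\<exists>A B C. f = (X3 - Const3 \<alpha>) * A + (Y3 - Const3 \<beta>) * B + (Z3 - Const3 \<gamma>) * C"
proof -
  have div: "\<exists>s. p = [:- c, 1:] * s + [:poly p c:]" for p and c :: "'b::comm_ring_1"
  proof -
    have "poly (p - [:poly p c:]) c = 0" by simp
    hence "[:- c, 1:] dvd p - [:poly p c:]" by (simp only: poly_eq_0_iff_dvd)
    thus ?thesis by (metis dvd_def diff_add_cancel)
  qed
  obtain C where C: "f = [:- [:[:\<gamma>:]:], 1:] * C + [:poly f [:[:\<gamma>:]:]:]" using div by blast
  obtain B where B: "poly f [:[:\<gamma>:]:] = [:- [:\<beta>:], 1:] * B + [:poly (poly f [:[:\<gamma>:]:]) [:\<beta>:]:]"
    using div by blast
  obtain A where A: "poly (poly f [:[:\<gamma>:]:]) [:\<beta>:] = [:- \<alpha>, 1:] * A"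
    using div[of "poly (poly f [:[:\<gamma>:]:]) [:\<beta>:]" \<alpha>] assms by (auto simp: eval3_def)
  have "f = [:- [:[:\<gamma>:]:], 1:] * C + [:[:- [:\<beta>:], 1:] * B + [:[:- \<alpha>, 1:] * A:]:]"
    using A B C by simp
  also have "\<dots> = (X3 - Const3 \<alpha>) * [:[:A:]:] + (Y3 - Const3 \<beta>) * [:B:] + (Z3 - Const3 \<gamma>) * C"
    by (simp add: X3_def Y3_def Z3_def Const3_def)
  finally show ?thesis by blast
qed

section \<open>The order of a function along a branch\<close>

lemma fps_X_power_dvd_iff:
  fixes f :: "'k::field fps"
  shows "fps_X ^ d dvd f \<longleftrightarrow> f = 0 \<or> d \<le> subdegree f"
  by (cases "f = 0") (simp_all add: fps_dvd_iff)

lemma ideal_power_max_ideal_dvd: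
  fixes x y z :: "'k::field fps"
  assumes "f \<in> ideal_power (max_ideal_at (fps_nth x 0, fps_nth y 0, fps_nth z 0)) d"
  shows "fps_X ^ d dvd eval_at fps_const (x, y, z) f"
  using assms
proof (induction d arbitrary: f)
  case (Suc d)
  note h = ring_map_eval_at[OF ring_map_fps_const, of "(x, y, z)"]
  show ?case
  proof (rule ring_map_dvd_ideal_gen[OF h])
    show "f \<in> ideal_gen {f * g |f g. f \<in> max_ideal_at (fps_nth x 0, fps_nth y 0, fps_nth z 0) \<and>
       g \<in> ideal_power (max_ideal_at (fps_nth x 0, fps_nth y 0, fps_nth z 0)) d}"
      using Suc.prems by simp
  next
    fix g assume "g \<in> {f * g |f g. f \<in> max_ideal_at (fps_nth x 0, fps_nth y 0, fps_nth z 0) \<and>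
       g \<in> ideal_power (max_ideal_at (fps_nth x 0, fps_nth y 0, fps_nth z 0)) d}"
    then obtain a b where g: "g = a * b" and a: "eval3 a (fps_nth x 0, fps_nth y 0, fps_nth z 0) = 0"
      and b: "fps_X ^ d dvd eval_at fps_const (x, y, z) b"
      using Suc.IH by (auto simp: max_ideal_at_def)
    have "fps_nth (eval_at fps_const (x, y, z) a) 0 = 0"
      using a by (simp add: eval_at_fps_nth_0)
    hence "fps_X ^ 1 dvd eval_at fps_const (x, y, z) a"
      unfolding fps_X_power_dvd_iff by (metis One_nat_def Suc_leI gr0I nth_subdegree_nonzero)
    thus "fps_X ^ Suc d dvd eval_at fps_const (x, y, z) g"
      using b by (simp add: g ring_map_simps[OF h] mult_dvd_mono)
  qed
qed auto

text \<open>
  The hypotheses describe a branch: a parametrization of the curve by \<open>\<tau> = z - \<gamma>\<close> over the power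
  series ring, and the fact that \<open>T\<close> generates the maximal ideal of the local ring, in the form
  that \<open>x - \<alpha>\<close> and \<open>y - \<beta>\<close> become multiples of \<open>T\<close> modulo the ideal of the curve after
  multiplication by denominators.  If \<open>g\<close> lies in the \<open>d\<close>-th power of the maximal ideal, then
  \<open>\<tau>^d\<close> divides its expansion.  Conversely, as long as the expansion is divisible by \<open>\<tau>^d\<close>, factors
  \<open>T\<close> can be split off from \<open>g\<close> one at a time.
\<close>

lemma ord_at_eq_subdegree:
  fixes S :: "'k::field poly3 set" and x y z :: "'k fps" and \<alpha> \<beta> \<gamma> :: 'k
  defines "\<phi> \<equiv> eval_at fps_const (x, y, z)" and "T \<equiv> Z3 - Const3 \<gamma>"
  assumes base: "fps_nth x 0 = \<alpha>" "fps_nth y 0 = \<beta>" and z: "z = fps_const \<gamma> + fps_X"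
    and S: "\<And>f. f \<in> S \<Longrightarrow> \<phi> f = 0"
    and X: "eval3 s1 (\<alpha>, \<beta>, \<gamma>) \<noteq> 0" "s1 * (X3 - Const3 \<alpha>) - T * A1 \<in> ideal_gen S"
    and Y: "eval3 s2 (\<alpha>, \<beta>, \<gamma>) \<noteq> 0" "s2 * (Y3 - Const3 \<beta>) - T * A2 \<in> ideal_gen S"
    and g: "\<phi> g \<noteq> 0"
  shows "ord_at (ideal_gen S) (\<alpha>, \<beta>, \<gamma>) g = enat (subdegree (\<phi> g))"
proof -
  let ?P = "(\<alpha>, \<beta>, \<gamma>)" and ?I = "ideal_gen S"
  have z0: "fps_nth z 0 = \<gamma>" by (simp add: z)
  note hP = ring_map_simps[OF ring_map_eval3[of ?P]]
  have h: "ring_map \<phi>" unfolding \<phi>_def by (rule ring_map_eval_at[OF ring_map_fps_const])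
  note h' = ring_map_simps[OF h]
  have nth0: "fps_nth (\<phi> f) 0 = eval3 f ?P" for f
    by (simp add: \<phi>_def eval_at_fps_nth_0 base z0)
  have \<phi>I: "\<phi> f = 0" if "f \<in> ?I" for f
    using ring_map_dvd_ideal_gen[OF h _ that, of 0] S by auto
  have \<phi>T: "\<phi> T = fps_X"
    by (simp add: T_def h' \<phi>_def[symmetric] eval_at_simps[OF ring_map_fps_const, of x y z, folded \<phi>_def] z)
  have evalT: "eval3 T ?P = 0"
    by (simp add: nth0[symmetric] \<phi>T)

  have upper: "d \<le> subdegree (\<phi> g)"
    if s: "eval3 s ?P \<noteq> 0" "s * g \<in> ideal_gen (ideal_power (max_ideal_at ?P) d \<union> ?I)" for s d
  proof -
    have "fps_X ^ d dvd \<phi> (s * g)"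
    proof (rule ring_map_dvd_ideal_gen[OF h _ s(2)])
      fix f assume "f \<in> ideal_power (max_ideal_at ?P) d \<union> ?I"
      thus "fps_X ^ d dvd \<phi> f"
        using ideal_power_max_ideal_dvd[of f x y z d] \<phi>I by (auto simp: base z0 \<phi>_def)
    qed
    moreover have "fps_nth (\<phi> s) 0 \<noteq> 0" using s(1) nth0 by simp
    hence "\<phi> s \<noteq> 0" "subdegree (\<phi> s) = 0" by auto
    ultimately show ?thesis using g by (simp add: fps_X_power_dvd_iff h')
  qed

  \<comment> \<open>Every function that vanishes at the point is a multiple of \<open>T\<close> in the local ring.\<close>
  have linear: "\<exists>s k. eval3 s ?P \<noteq> 0 \<and> s * f - T * k \<in> ?I" if f0: "eval3 f ?P = 0" for f
  proof -
    obtain A B C where f: "f = (X3 - Const3 \<alpha>) * A + (Y3 - Const3 \<beta>) * B + T * C"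
      using max_ideal_at_decompose[OF f0] unfolding T_def by blast
    have "s1 * s2 * f - T * (s2 * A * A1 + s1 * B * A2 + s1 * s2 * C)
        = (s2 * A) * (s1 * (X3 - Const3 \<alpha>) - T * A1) + (s1 * B) * (s2 * (Y3 - Const3 \<beta>) - T * A2)"
      unfolding f by (simp add: algebra_simps)
    also have "\<dots> \<in> ?I"
      using X(2) Y(2) by (intro ideal_gen_add ideal_gen_mult)
    finally have "s1 * s2 * f - T * (s2 * A * A1 + s1 * B * A2 + s1 * s2 * C) \<in> ?I" .
    moreover have "eval3 (s1 * s2) ?P \<noteq> 0" using X(1) Y(1) by (simp add: hP)
    ultimately show ?thesis by blast
  qed

  have lower: "\<exists>s k. eval3 s ?P \<noteq> 0 \<and> s * g - T ^ d * k \<in> ?I" if "d \<le> subdegree (\<phi> g)" for d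
    using that
  proof (induction d)
    case 0
    show ?case by (rule exI[of _ 1], rule exI[of _ g]) (simp add: hP ideal_gen_0)
  next
    case (Suc d)
    then obtain s k where s: "eval3 s ?P \<noteq> 0" "s * g - T ^ d * k \<in> ?I" by auto
    have eq: "\<phi> s * \<phi> g = fps_X ^ d * \<phi> k"
      using \<phi>I[OF s(2)] by (simp add: h' \<phi>T)
    have "fps_X ^ d * fps_X dvd \<phi> s * \<phi> g"
      using Suc.prems fps_X_power_dvd_iff[of "Suc d" "\<phi> g"]
      by (intro dvd_mult) (simp add: mult.commute)
    hence "fps_X dvd \<phi> k" unfolding eq by simp
    hence "eval3 k ?P = 0" by (auto simp: nth0[symmetric] dvd_def)
    then obtain s' k' where s': "eval3 s' ?P \<noteq> 0" "s' * k - T * k' \<in> ?I" using linear by blast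
    have "(s' * s) * g - T ^ Suc d * k' = s' * (s * g - T ^ d * k) + T ^ d * (s' * k - T * k')"
      by (simp add: algebra_simps)
    also have "\<dots> \<in> ?I" using s(2) s'(2) by (intro ideal_gen_add ideal_gen_mult)
    finally show ?case using s(1) s'(1) by (metis hP(4) no_zero_divisors)
  qed

  have T_power: "T ^ d \<in> ideal_power (max_ideal_at ?P) d" for d
  proof (induction d)
    case (Suc d)
    thus ?case using evalT by (auto intro!: ideal_gen_base simp: max_ideal_at_def)
  qed auto
  have "{enat d |d. \<exists>s. eval3 s ?P \<noteq> 0 \<and> s * g \<in> ideal_gen (ideal_power (max_ideal_at ?P) d \<union> ?I)}
      = {enat d |d. d \<le> subdegree (\<phi> g)}"
  proof -
    have "\<exists>s. eval3 s ?P \<noteq> 0 \<and> s * g \<in> ideal_gen (ideal_power (max_ideal_at ?P) d \<union> ?I)"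
      if d: "d \<le> subdegree (\<phi> g)" for d
    proof -
      obtain s k where s: "eval3 s ?P \<noteq> 0" "s * g - T ^ d * k \<in> ?I" using lower[OF d] by blast
      have "?I \<subseteq> ideal_gen (ideal_power (max_ideal_at ?P) d \<union> ?I)"
        by (auto intro: ideal_gen_base)
      hence "s * g - T ^ d * k + k * T ^ d \<in> ideal_gen (ideal_power (max_ideal_at ?P) d \<union> ?I)"
        using s(2) T_power[of d] by (intro ideal_gen_add ideal_gen_mult ideal_gen_base) auto
      thus ?thesis using s(1) by (auto simp: algebra_simps)
    qed
    thus ?thesis using upper by blast
  qed
  moreover have "Sup {enat d |d. d \<le> subdegree (\<phi> g)} = enat (subdegree (\<phi> g))"
    by (intro antisym Sup_least Sup_upper) auto
  ultimately show ?thesis by (simp add: ord_at_def)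
qed

section \<open>Fixed points in power series rings\<close>

text \<open>
  Raising to a power \<open>k \<ge> 2\<close> contracts differences of power series without constant term, so the
  iteration started at 0 converges.
\<close>

lemma fps_fixed_point:
  fixes e :: "'k::field fps" and \<sigma> :: 'k
  assumes e: "fps_nth e 0 = 0" and k: "k \<ge> 2"
  shows "\<exists>u. fps_nth u 0 = 0 \<and> u = e + fps_const \<sigma> * u ^ k"
proof -
  define S where "S = rec_nat 0 (\<lambda>_ s. e + fps_const \<sigma> * s ^ k)"
  have S0: "S 0 = 0" and S_Suc: "S (Suc i) = e + fps_const \<sigma> * S i ^ k" for i
    by (simp_all add: S_def)
  have S_nth_0: "fps_nth (S i) 0 = 0" for i
    using e k by (induction i) (simp_all add: S0 S_Suc)
  have X: "fps_X dvd f \<longleftrightarrow> fps_nth f 0 = 0" for f :: "'k fps"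
    using fps_X_power_dvd_iff[of 1 f] by (auto simp: Suc_le_eq subdegree_eq_0_iff)
  have contract: "fps_X ^ Suc i dvd a ^ k - b ^ k"
    if "fps_X ^ i dvd a - b" "fps_nth a 0 = 0" "fps_nth b 0 = 0" for a b :: "'k fps" and i
  proof -
    have "(0::'k) ^ (k - Suc j) * 0 ^ j = 0" for j
      using k by (cases j) auto
    hence "fps_X dvd (\<Sum>j<k. b ^ (k - Suc j) * a ^ j)"
      using that k by (simp add: X fps_sum_nth ring_map_simps[OF ring_map_fps_nth_0])
    thus ?thesis
      using that(1) by (simp add: power_diff_sumr2 mult_dvd_mono power_Suc2 del: power_Suc)
  qed
  \<comment> \<open>Coefficient \<open>m\<close> of the iterates is constant from step \<open>m\<close> on.\<close>
  have step: "fps_X ^ Suc i dvd S (Suc i) - S i" for i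
  proof (induction i)
    case 0
    thus ?case using e k by (simp add: S0 S_Suc X)
  next
    case (Suc i)
    have "S (Suc (Suc i)) - S (Suc i) = fps_const \<sigma> * (S (Suc i) ^ k - S i ^ k)"
      by (simp add: S_Suc[of "Suc i"] S_Suc[of i] algebra_simps)
    thus ?case using contract[OF Suc S_nth_0 S_nth_0] by (metis dvd_mult)
  qed
  have stable: "fps_nth (S (i + j)) m = fps_nth (S i) m" if "m \<le> i" for i j m
  proof (induction j)
    case (Suc j)
    obtain v where "S (Suc (i + j)) - S (i + j) = fps_X ^ Suc (i + j) * v"
      using step[of "i + j"] by (elim dvdE)
    hence "fps_nth (S (Suc (i + j)) - S (i + j)) m = 0"
      using that by (simp add: fps_X_power_mult_nth del: power_Suc fps_sub_nth)
    thus ?case using Suc by simp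
  qed auto
  define u where "u = Abs_fps (\<lambda>m. fps_nth (S m) m)"
  have u0: "fps_nth u 0 = 0" by (simp add: u_def S0)
  have close: "fps_X ^ Suc i dvd u - S i" for i
  proof -
    have "fps_nth (u - S i) m = 0" if "m < Suc i" for m
      using stable[of m m "i - m"] that by (simp add: u_def)
    thus ?thesis unfolding fps_X_power_dvd_iff by (metis subdegree_geI)
  qed
  have "fps_X ^ Suc i dvd u - (e + fps_const \<sigma> * u ^ k)" for i
  proof -
    have c1: "fps_X ^ Suc i dvd u - S (Suc i)"
      using close[of "Suc i"] by (metis dvd_mult_right power_Suc)
    have c2: "fps_X ^ Suc i dvd u ^ k - S i ^ k"
      using contract[OF close u0 S_nth_0, of i] by (metis dvd_mult_right power_Suc)
    have "fps_X ^ Suc i dvd (u - S (Suc i)) - fps_const \<sigma> * (u ^ k - S i ^ k)"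
      by (rule dvd_diff[OF c1 dvd_mult[OF c2]])
    thus ?thesis by (simp add: S_Suc algebra_simps)
  qed
  hence "u - (e + fps_const \<sigma> * u ^ k) = 0"
    unfolding fps_X_power_dvd_iff by (metis Suc_n_not_le_n)
  thus ?thesis using u0 by auto
qed

section \<open>Branches of the curve\<close>

lemma eval_at_surface:
  assumes h: "ring_map h"
  shows "eval_at h (x, y, z) (gk_surface Z a b c) = x + h a - h b * y - poly (map_poly h Z) (h c * z)"
  unfolding gk_surface_def
  by (simp add: ring_map_simps[OF ring_map_eval_at[OF h]] eval_at_simps[OF h]
      ring_map_poly_map_poly[OF ring_map_eval_at[OF h] ring_map_Const3])

context gk_setting
begin

definition on_curve :: "'f alg_closure \<Rightarrow> 'f alg_closure \<Rightarrow> 'f alg_closure \<Rightarrow> bool" where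
  "on_curve x y z \<longleftrightarrow> frob q 1 x + x = y * frob q 1 y \<and> frob q 2 y - y = z ^ r"

lemma gk_generators:
  "gk_ideal q n = ideal_gen {frob q 1 X3 + X3 - Y3 * frob q 1 Y3, frob q 2 Y3 - Y3 - Z3 ^ r}"
  by (simp add: gk_ideal_def frob_def)

lemma on_curve_iff: "(x, y, z) \<in> gk_curve q n \<longleftrightarrow> on_curve x y z"
proof -
  note e = eval_at_simps[OF ring_map_id, folded eval3_eq_eval_at] ring_map_simps[OF ring_map_eval3]
  let ?S = "{X3 ^ q + X3 - Y3 ^ (q + 1), Y3 ^ (q ^ 2) - Y3 - Z3 ^ r} :: 'f alg_closure poly3 set"
  have S: "(\<forall>f\<in>?S. eval3 f (x, y, z) = 0) \<longleftrightarrow> on_curve x y z"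
    by (auto simp: e on_curve_def frob_def)
  have "on_curve x y z" if "(x, y, z) \<in> gk_curve q n"
    using that S ideal_gen_base[of _ ?S] unfolding gk_curve_def gk_ideal_def zero_locus_def by blast
  moreover have "eval3 f (x, y, z) = 0" if "on_curve x y z" "f \<in> gk_ideal q n" for f
    using ring_map_dvd_ideal_gen[OF ring_map_eval3, of ?S 0 "(x, y, z)" f] that S
    unfolding gk_ideal_def by auto
  ultimately show ?thesis unfolding gk_curve_def zero_locus_def by blast
qed

lemma on_curve_frob:
  assumes "on_curve x y z"
  shows "on_curve (frob q i x) (frob q i y) (frob q i z)"
  using assms[unfolded on_curve_def, THEN conjunct1, THEN arg_cong, of "frob q i"]
    assms[unfolded on_curve_def, THEN conjunct2, THEN arg_cong, of "frob q i"]
  by (simp add: on_curve_def add.commute)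

definition branch ::
    "'f alg_closure \<Rightarrow> 'f alg_closure \<Rightarrow> 'f alg_closure \<Rightarrow>
      'f alg_closure fps \<Rightarrow> 'f alg_closure fps \<Rightarrow> 'f alg_closure fps \<Rightarrow> bool" where
  "branch \<alpha> \<beta> \<gamma> x y z \<longleftrightarrow> fps_nth x 0 = \<alpha> \<and> fps_nth y 0 = \<beta> \<and> z = fps_const \<gamma> + fps_X \<and>
     frob q 1 x + x = y * frob q 1 y \<and> frob q 2 y - y = z ^ r"

text \<open>
  Both equations of the curve have the shape required by the fixed point lemma: \<open>y - \<beta>\<close> is a
  fixed point of \<open>u \<mapsto> e + u^(q^2)\<close> and \<open>x - \<alpha>\<close> one of \<open>v \<mapsto> e - v^q\<close>.
\<close>

lemma branch_exists:
  assumes "on_curve \<alpha> \<beta> \<gamma>"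
  shows "\<exists>x y z. branch \<alpha> \<beta> \<gamma> x y z"
proof -
  define z where "z = fps_const \<gamma> + fps_X"
  have "fps_nth (fps_const (\<gamma> ^ r) - z ^ r) 0 = 0"
    by (simp add: z_def ring_map_simps[OF ring_map_fps_nth_0])
  moreover have "q ^ 2 \<ge> 2" using K.q_gt_1 by (metis Suc_1 Suc_leI one_less_power pos2)
  ultimately obtain u where u: "fps_nth u 0 = 0" "u = fps_const (\<gamma> ^ r) - z ^ r + fps_const 1 * u ^ (q ^ 2)"
    using fps_fixed_point by blast
  define y where "y = fps_const \<beta> + u"
  have "frob q 2 y - y = fps_const (frob q 2 \<beta> - \<beta>) + (frob q 2 u - u)"
    by (simp add: y_def frob_fps_const del: fps_const_sub)
  also have "frob q 2 u - u = z ^ r - fps_const (\<gamma> ^ r)"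
    using u(2) by (simp add: frob_def algebra_simps)
  finally have y: "frob q 2 y - y = z ^ r"
    using assms by (simp add: on_curve_def)
  have y0: "fps_nth y 0 = \<beta>" by (simp add: y_def u(1))
  have "fps_nth (y * frob q 1 y - fps_const (\<beta> * frob q 1 \<beta>)) 0 = 0"
    by (simp add: frob_fps_nth_0 y0)
  moreover have "q \<ge> 2" using K.q_gt_1 by simp
  ultimately obtain v where v: "fps_nth v 0 = 0"
    "v = y * frob q 1 y - fps_const (\<beta> * frob q 1 \<beta>) + fps_const (-1) * v ^ q"
    using fps_fixed_point by blast
  define x where "x = fps_const \<alpha> + v"
  have "frob q 1 x + x = fps_const (frob q 1 \<alpha> + \<alpha>) + (frob q 1 v + v)"
    by (simp add: x_def frob_fps_const flip: fps_const_add)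
  also have "frob q 1 v + v = y * frob q 1 y - fps_const (\<beta> * frob q 1 \<beta>)"
    using v(2) by (simp add: frob_def fps_const_neg[symmetric] algebra_simps del: fps_const_neg)
  finally have "frob q 1 x + x = y * frob q 1 y"
    using assms by (simp add: on_curve_def)
  moreover have "fps_nth x 0 = \<alpha>" by (simp add: x_def v(1))
  ultimately have "branch \<alpha> \<beta> \<gamma> x y z"
    using y y0 z_def by (simp only: branch_def)
  thus ?thesis by blast
qed

text \<open>
  Since the \<open>q\<close>-th power map is additive, \<open>y - \<beta> - (y - \<beta>)^(q^2)\<close> equals \<open>\<gamma>^r - z^r\<close> on the curve,
  which is a multiple of \<open>z - \<gamma>\<close>; so the denominator \<open>1 - (y - \<beta>)^(q^2-1)\<close> turns \<open>y - \<beta>\<close> into a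
  multiple of \<open>z - \<gamma>\<close>.  In the same way \<open>1 + (x - \<alpha>)^(q-1)\<close> turns \<open>x - \<alpha>\<close> into a multiple of
  \<open>y - \<beta>\<close>.
\<close>

lemma ord_at_branch:
  assumes P: "on_curve \<alpha> \<beta> \<gamma>" and br: "branch \<alpha> \<beta> \<gamma> x y z"
    and g: "eval_at fps_const (x, y, z) g \<noteq> 0"
  shows "ord_at (gk_ideal q n) (\<alpha>, \<beta>, \<gamma>) g = enat (subdegree (eval_at fps_const (x, y, z) g))"
proof -
  interpret K3: frobenius_ring q "TYPE('f alg_closure poly poly poly)"
    using frobenius_ring_finite_field[where 'r = "'f alg_closure poly poly poly" and 'f = 'f] by (simp add: q_eq)
  note c = ring_map_simps[OF ring_map_Const3]
  note e = eval_at_simps[OF ring_map_id, folded eval3_eq_eval_at] ring_map_simps[OF ring_map_eval3]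
  note ef = eval_at_simps[OF ring_map_fps_const] ring_map_simps[OF ring_map_eval_at[OF ring_map_fps_const]]
  define G1 where "G1 = frob q 1 X3 + X3 - Y3 * frob q 1 (Y3 :: 'f alg_closure poly3)"
  define G2 where "G2 = frob q 2 Y3 - Y3 - (Z3 :: 'f alg_closure poly3) ^ r"
  define T where "T = Z3 - Const3 \<gamma>"
  define U where "U = X3 - Const3 \<alpha>"
  define V where "V = Y3 - Const3 \<beta>"
  have frob_Const3: "frob q i (Const3 u) = Const3 (frob q i u)" for i and u :: "'f alg_closure"
    by (simp add: frob_def c)
  have P1: "Const3 \<beta> * frob q 1 (Const3 \<beta>) = frob q 1 (Const3 \<alpha>) + Const3 \<alpha>"
    and P2: "Const3 \<gamma> ^ r = frob q 2 (Const3 \<beta>) - Const3 \<beta>"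
    using P by (simp_all add: on_curve_def frob_Const3 flip: c)
  have q0: "q \<noteq> 0" "q ^ 2 \<noteq> 0" using K.q_gt_1 by auto
  define s2 where "s2 = 1 - V ^ (q ^ 2 - 1)"
  define s1 where "s1 = s2 * (1 + U ^ (q - 1))"
  define W where "W = frob q 1 Y3 + Const3 \<beta> * V ^ (q - 1)"
  obtain A where A: "Z3 ^ r - Const3 \<gamma> ^ r = T * A"
    unfolding T_def by (metis power_diff_sumr2)
  have s2: "s2 * V = V - frob q 2 V"
    using q0(2) by (simp add: s2_def frob_def algebra_simps power_eq_if[of V "q ^ 2"])
  have "V - frob q 2 V = - G2 - (Z3 ^ r - Const3 \<gamma> ^ r)"
    by (simp add: V_def G2_def P2)
  hence s2V: "s2 * V - T * (- A) = - 1 * G2"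
    unfolding s2 A by simp
  have "(1 + U ^ (q - 1)) * U = U + frob q 1 U"
    using q0(1) by (simp add: frob_def algebra_simps power_eq_if[of U q])
  also have "\<dots> = G1 + (Y3 * frob q 1 Y3 - Const3 \<beta> * frob q 1 (Const3 \<beta>))"
    unfolding P1 by (simp add: U_def G1_def)
  also have "Y3 * frob q 1 Y3 - Const3 \<beta> * frob q 1 (Const3 \<beta>) = V * (frob q 1 Y3 + Const3 \<beta> * V ^ (q - 1))"
  proof -
    have "V * V ^ (q - 1) = frob q 1 V"
      using q0(1) by (simp add: frob_def power_eq_if[of V q])
    hence 1: "frob q 1 Y3 - frob q 1 (Const3 \<beta>) = V * V ^ (q - 1)"
      by (simp add: V_def)
    have "Y3 * frob q 1 Y3 - Const3 \<beta> * frob q 1 (Const3 \<beta>)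
        = V * frob q 1 Y3 + Const3 \<beta> * (frob q 1 Y3 - frob q 1 (Const3 \<beta>))"
      by (simp add: V_def algebra_simps)
    thus ?thesis unfolding 1 by (simp add: algebra_simps)
  qed
  finally have "(1 + U ^ (q - 1)) * U = G1 + V * W" by (simp only: W_def)
  hence "s1 * U = s2 * (G1 + V * W)"
    by (simp only: s1_def mult.assoc)
  hence "s1 * U - T * (- A * W) = s2 * G1 + (s2 * V - T * (- A)) * W"
    by (simp add: algebra_simps)
  hence s1U: "s1 * U - T * (- A * W) = s2 * G1 + (- W) * G2"
    unfolding s2V by simp
  have ev: "eval3 V (\<alpha>, \<beta>, \<gamma>) = 0" "eval3 U (\<alpha>, \<beta>, \<gamma>) = 0"
    by (simp_all add: U_def V_def e)
  have pos: "0 < q - 1" "0 < q ^ 2 - 1"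
    using K.q_gt_1 by (auto simp: power2_eq_square one_less_mult)
  show ?thesis
    unfolding gk_generators G1_def[symmetric] G2_def[symmetric]
  proof (rule ord_at_eq_subdegree)
    show "fps_nth x 0 = \<alpha>" "fps_nth y 0 = \<beta>" "z = fps_const \<gamma> + fps_X"
      using br by (auto simp: branch_def)
    show "eval_at fps_const (x, y, z) f = 0" if "f \<in> {G1, G2}" for f
      using that br by (auto simp: G1_def G2_def branch_def frob_def ef)
    show "eval3 s1 (\<alpha>, \<beta>, \<gamma>) \<noteq> 0" "eval3 s2 (\<alpha>, \<beta>, \<gamma>) \<noteq> 0"
      using pos by (simp_all add: s1_def s2_def e ev power_0_left)
    show "s1 * (X3 - Const3 \<alpha>) - (Z3 - Const3 \<gamma>) * (- A * W) \<in> ideal_gen {G1, G2}"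
      unfolding s1U[unfolded U_def T_def] by (intro ideal_gen_add ideal_gen_mult ideal_gen_base) auto
    show "s2 * (Y3 - Const3 \<beta>) - (Z3 - Const3 \<gamma>) * (- A) \<in> ideal_gen {G1, G2}"
      using ideal_gen_mult[OF ideal_gen_base, of G2 "{G1, G2}" "-1"] unfolding s2V[unfolded V_def T_def] by blast
    show "eval_at fps_const (x, y, z) g \<noteq> 0" by (rule g)
  qed
qed

text \<open>
  Differentiate the two equations of the curve; all \<open>q\<close>-th powers have derivative 0.
\<close>

lemma branch_tangent:
  assumes br: "branch \<alpha> \<beta> \<gamma> x y z"
  shows "fps_nth y 1 = - (\<gamma> ^ (r - 1))" "fps_nth x 1 = - (frob q 1 \<beta> * \<gamma> ^ (r - 1))"
proof -
  have d: "fps_deriv (frob q i u) = 0" if "i \<noteq> 0" for i and u :: "'f alg_closure fps"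
    using that by (simp add: frob_def fps_deriv_power of_nat_q)
  have b: "fps_nth y 0 = \<beta>" "z = fps_const \<gamma> + fps_X" "frob q 1 x + x = y * frob q 1 y" "frob q 2 y - y = z ^ r"
    using br by (auto simp: branch_def)
  have "fps_deriv (frob q 2 y - y) = fps_deriv (z ^ r)" using b(4) by simp
  hence "- fps_deriv y = z ^ (r - 1)"
    by (simp add: d fps_deriv_power of_nat_r b(2))
  hence y': "fps_deriv y = - (z ^ (r - 1))" by (metis minus_minus)
  have "fps_deriv (frob q 1 x + x) = fps_deriv (y * frob q 1 y)" using b(3) by simp
  hence x': "fps_deriv x = - (frob q 1 y * z ^ (r - 1))"
    by (simp add: d y' mult.commute)
  show "fps_nth y 1 = - (\<gamma> ^ (r - 1))"
    using arg_cong[OF y', of "\<lambda>f. fps_nth f 0"] b(2) by (simp add: ring_map_simps[OF ring_map_fps_nth_0])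
  show "fps_nth x 1 = - (frob q 1 \<beta> * \<gamma> ^ (r - 1))"
    using arg_cong[OF x', of "\<lambda>f. fps_nth f 0"] b(1,2) by (simp add: ring_map_simps[OF ring_map_fps_nth_0] frob_fps_nth_0)
qed

section \<open>Multiplicities\<close>

abbreviation surface_of where
  "surface_of \<alpha> \<beta> \<gamma> \<equiv> gk_surface Z (frob q n \<alpha>) (frob q n \<beta>) (frob q n \<gamma>)"

text \<open>
  Subtract the identity for \<open>x + x^Q\<close> along the branch from \<open>f\<close>.  What remains involves \<open>x^Q - a\<close>,
  \<open>y^Q - b\<close> and \<open>z^Q - c\<close>, all of which are divisible by \<open>\<tau>^Q\<close>.
\<close>

lemma surface_expansion:
  assumes br: "branch \<alpha> \<beta> \<gamma> x y z"
  shows "\<exists>s. eval_at fps_const (x, y, z) (surface_of \<alpha> \<beta> \<gamma>) = fps_X ^ (q ^ n) * s \<and> fps_nth s 0 = \<kappa> \<beta> \<gamma>"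
proof -
  have b: "fps_nth x 0 = \<alpha>" "fps_nth y 0 = \<beta>" "z = fps_const \<gamma> + fps_X" "frob q 1 x + x = y * frob q 1 y" "frob q 2 y - y = z ^ r"
    using br by (auto simp: branch_def)
  have lin: "\<exists>v. u = fps_const (fps_nth u 0) + fps_X * v \<and> fps_nth v 0 = fps_nth u 1" for u :: "'f alg_closure fps"
    by (rule exI[of _ "fps_shift 1 u"]) (simp add: fps_eq_iff)
  obtain x1 where x1: "x = fps_const \<alpha> + fps_X * x1" "fps_nth x1 0 = fps_nth x 1" using lin[of x] b(1) by auto
  obtain y1 where y1: "y = fps_const \<beta> + fps_X * y1" "fps_nth y1 0 = fps_nth y 1" using lin[of y] b(2) by auto
  let ?\<tau> = "fps_X ^ (q ^ n) :: 'f alg_closure fps"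
  let ?Z = "map_poly fps_const Z" and ?a = "fps_const (frob q n \<alpha>)" and ?b = "fps_const (frob q n \<beta>)"
    and ?c = "fps_const (frob q n \<gamma>)"
  have \<tau>: "frob q n (fps_X :: 'f alg_closure fps) = ?\<tau>" by (simp add: frob_def)
  have xQ: "frob q n x = ?a + ?\<tau> * frob q n x1" unfolding x1(1) by (simp add: frob_fps_const \<tau>)
  have yQ: "frob q n y = ?b + ?\<tau> * frob q n y1" unfolding y1(1) by (simp add: frob_fps_const \<tau>)
  have zQ: "frob q n z = ?c + ?\<tau>" unfolding b(3) by (simp add: frob_fps_const \<tau>)
  \<comment> \<open>\<open>Z\<close> is expanded at \<open>c z\<close> with increment \<open>z^(Q+1) - c z = \<tau>^Q z\<close>.\<close>
  obtain s where s: "poly ?Z (?c * z + ?\<tau> * z) = poly ?Z (?c * z) + (?\<tau> * z) * poly (pderiv ?Z) (?c * z) + (?\<tau> * z) ^ 2 * s"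
    using poly_Taylor_square by blast
  have "x + frob q n x = y * frob q n y + poly ?Z (z * frob q n z)"
    by (rule Z_on_curve[OF K_fps.frobenius_ring_axioms ring_map_fps_const b(4,5)])
  hence "x + ?a - ?b * y - poly ?Z (?c * z) = ?\<tau> * (- frob q n x1 + frob q n y1 * y + z * poly (pderiv ?Z) (?c * z) + ?\<tau> * (z ^ 2 * s))"
  proof -
    have "z * frob q n z = ?c * z + ?\<tau> * z" unfolding zQ by (simp add: algebra_simps)
    hence "x + (?a + ?\<tau> * frob q n x1) = y * (?b + ?\<tau> * frob q n y1) +
      (poly ?Z (?c * z) + (?\<tau> * z) * poly (pderiv ?Z) (?c * z) + (?\<tau> * z) ^ 2 * s)"
      using \<open>x + frob q n x = y * frob q n y + poly ?Z (z * frob q n z)\<close> unfolding xQ yQ s[symmetric] by simp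
    thus ?thesis by (simp add: algebra_simps power2_eq_square)
  qed
  moreover have "fps_nth (- frob q n x1 + frob q n y1 * y + z * poly (pderiv ?Z) (?c * z) + ?\<tau> * (z ^ 2 * s)) 0 = \<kappa> \<beta> \<gamma>"
  proof -
    have "q ^ n > 0" using K.q_gt_1 by simp
    hence \<tau>0: "fps_nth ?\<tau> 0 = 0" by (simp add: ring_map_simps[OF ring_map_fps_nth_0] power_0_left)
    have z0: "fps_nth z 0 = \<gamma>" by (simp add: b(3))
    have "fps_nth (poly (map_poly fps_const (pderiv Z)) (?c * z)) 0 = poly (pderiv Z) (\<gamma> * frob q n \<gamma>)"
      using ring_map_poly_map_poly[OF ring_map_fps_nth_0 ring_map_fps_const, of "pderiv Z" "?c * z"]
      by (simp add: z0 mult.commute)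
    thus ?thesis
      using K.q_gt_1 by (simp add: map_poly_fps_const_pderiv frob_fps_nth_0 \<tau>0 z0 x1(2) y1(2) b branch_tangent[OF br, unfolded One_nat_def] \<kappa>_def algebra_simps)
  qed
  ultimately show ?thesis
    unfolding eval_at_surface[OF ring_map_fps_const] by blast
qed

lemma surface_first_order:
  assumes br: "branch x0 y0 z0 x y z"
  shows "fps_nth (eval_at fps_const (x, y, z) (gk_surface Z a b c)) 1 =
    - ((frob q 1 y0 - b) * z0 ^ (r - 1) + c * poly (pderiv Z) (c * z0))"
proof -
  let ?Z = "map_poly fps_const Z"
  have z: "z = fps_const z0 + fps_X" using br by (simp add: branch_def)
  obtain s where s: "poly ?Z (fps_const (c * z0) + fps_const c * fps_X) =
      poly ?Z (fps_const (c * z0)) + (fps_const c * fps_X) * poly (pderiv ?Z) (fps_const (c * z0)) + (fps_const c * fps_X) ^ 2 * s"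
    using poly_Taylor_square by blast
  have arg: "fps_const c * z = fps_const (c * z0) + fps_const c * fps_X"
    unfolding z by (simp add: distrib_left)
  have "fps_nth (poly ?Z (fps_const c * z)) 1 = c * poly (pderiv Z) (c * z0)"
    unfolding arg s map_poly_fps_const_pderiv poly_map_poly_ring_map[OF ring_map_fps_const]
    by (simp add: power2_eq_square mult.assoc)
  thus ?thesis
    unfolding eval_at_surface[OF ring_map_fps_const] using branch_tangent[OF br]
    by (simp add: algebra_simps)
qed


text \<open>
  If \<open>P\<close> is fixed by the \<open>Q^2\<close>-power map, then \<open>\<kappa> = 0\<close> gives order at least \<open>Q + 1\<close>, and the upper
  bound comes from the divisor \<open>(z^Q - c) (c^Q - z)\<close>, which is \<open>- \<tau>^(Q+1)\<close> in this case.
\<close>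

lemma ord_at_surface_base_point:
  assumes P: "on_curve \<alpha> \<beta> \<gamma>"
  shows "ord_at (gk_ideal q n) (\<alpha>, \<beta>, \<gamma>) (surface_of \<alpha> \<beta> \<gamma>) =
    (if frob q (2 * n) \<gamma> = \<gamma> \<and> frob q (2 * n) \<beta> = \<beta> then enat (q ^ n + 1) else enat (q ^ n))"
proof -
  obtain x y z where br: "branch \<alpha> \<beta> \<gamma> x y z" using branch_exists[OF P] by blast
  define f where "f = eval_at fps_const (x, y, z) (surface_of \<alpha> \<beta> \<gamma>)"
  obtain s where s: "f = fps_X ^ (q ^ n) * s" "fps_nth s 0 = \<kappa> \<beta> \<gamma>"
    using surface_expansion[OF br] unfolding f_def by blast
  have \<kappa>0: "\<kappa> \<beta> \<gamma> = 0 \<longleftrightarrow> frob q (2 * n) \<gamma> = \<gamma> \<and> frob q (2 * n) \<beta> = \<beta>"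
    using P by (intro \<kappa>_eq_0_iff) (simp add: on_curve_def)
  show ?thesis
  proof (cases "\<kappa> \<beta> \<gamma> = 0")
    case False
    hence "s \<noteq> 0" "subdegree s = 0" using s(2) by auto
    hence "f \<noteq> 0" "subdegree f = q ^ n" by (simp_all add: s(1))
    thus ?thesis
      using ord_at_branch[OF P br, folded f_def] False \<kappa>0 unfolding f_def by auto
  next
    case True
    hence fixed: "frob q (2 * n) \<gamma> = \<gamma>" using \<kappa>0 by simp
    have z: "z = fps_const \<gamma> + fps_X" using br by (simp add: branch_def)
    have P': "on_curve (frob q n \<alpha>) (frob q n \<beta>) (frob q n \<gamma>)" by (rule on_curve_frob[OF P])
    have "x + fps_const (frob q n \<alpha>) - fps_const (frob q n \<beta>) * y - poly (map_poly fps_const Z) (fps_const (frob q n \<gamma>) * z)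
      dvd (frob q n z - fps_const (frob q n \<gamma>)) * (frob q n (fps_const (frob q n \<gamma>)) - z)"
    proof (rule surface_dvd[OF K_fps.frobenius_ring_axioms ring_map_fps_const])
      show "frob q 1 (fps_const (frob q n \<alpha>)) + fps_const (frob q n \<alpha>) = fps_const (frob q n \<beta>) * frob q 1 (fps_const (frob q n \<beta>))"
        "frob q 2 (fps_const (frob q n \<beta>)) - fps_const (frob q n \<beta>) = fps_const (frob q n \<gamma>) ^ r"
        unfolding frob_fps_const using P' by (simp_all only: on_curve_def fps_const_add fps_const_mult fps_const_sub fps_const_power)
    qed (use br in \<open>auto simp: branch_def\<close>)
    also have "frob q n z - fps_const (frob q n \<gamma>) = fps_X ^ (q ^ n)"
      unfolding z by (simp add: frob_fps_const) (simp add: frob_def)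
    also have "frob q n (fps_const (frob q n \<gamma>)) - z = - fps_X"
      unfolding frob_fps_const z using fixed by (simp add: mult_2)
    finally have dvd: "f dvd fps_X ^ (q ^ n + 1)"
      by (simp add: f_def eval_at_surface[OF ring_map_fps_const] mult.commute)
    hence f0: "f \<noteq> 0" by (metis dvd_0_left fps_X_neq_zero power_not_zero)
    have "subdegree f \<le> subdegree (fps_X ^ (q ^ n + 1) :: 'f alg_closure fps)"
      using dvd f0 by (subst (asm) fps_dvd_iff) (simp_all del: power_Suc)
    hence "subdegree f \<le> q ^ n + 1" by simp
    moreover have "s \<noteq> 0" "subdegree s \<noteq> 0" using f0 s True by (auto simp: subdegree_eq_0_iff)
    hence "subdegree f \<ge> q ^ n + 1" by (simp add: s(1))
    ultimately have "subdegree f = q ^ n + 1" by simp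
    thus ?thesis
      using ord_at_branch[OF P br, folded f_def] f0 True \<kappa>0 unfolding f_def by auto
  qed
qed

text \<open>
  Since \<open>P'\<close> is the \<open>Q\<close>-th power of \<open>P^Q\<close>, the linear coefficient of \<open>f\<close> at \<open>P'\<close> is the value of
  \<open>- \<kappa>\<close> at \<open>P^Q\<close>.  It is nonzero because \<open>P^Q\<close> is moved whenever \<open>P\<close> is.
\<close>

lemma ord_at_surface_frobenius_image:
  assumes P: "on_curve \<alpha> \<beta> \<gamma>"
    and moved: "\<not> (frob q (2 * n) \<gamma> = \<gamma> \<and> frob q (2 * n) \<beta> = \<beta>)"
  shows "ord_at (gk_ideal q n) (frob q (2 * n) \<alpha>, frob q (2 * n) \<beta>, frob q (2 * n) \<gamma>) (surface_of \<alpha> \<beta> \<gamma>) = 1"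
proof -
  let ?a1 = "frob q (2 * n) \<alpha>" and ?b1 = "frob q (2 * n) \<beta>" and ?c1 = "frob q (2 * n) \<gamma>"
  have P1: "on_curve ?a1 ?b1 ?c1" and PQ: "on_curve (frob q n \<alpha>) (frob q n \<beta>) (frob q n \<gamma>)"
    by (rule on_curve_frob[OF P])+
  obtain x y z where br: "branch ?a1 ?b1 ?c1 x y z" using branch_exists[OF P1] by blast
  define f where "f = eval_at fps_const (x, y, z) (surface_of \<alpha> \<beta> \<gamma>)"
  have "?a1 + frob q n \<alpha> - frob q n \<beta> * ?b1 - poly Z (frob q n \<gamma> * ?c1) = 0"
    using surface_zeros[of ?a1 ?b1 ?c1 \<alpha> \<beta> \<gamma>] P P1 unfolding on_curve_def by blast
  hence nth0: "fps_nth f 0 = 0"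
    using br unfolding f_def eval_at_fps_nth_0 eval3_eq_eval_at eval_at_surface[OF ring_map_id]
    by (simp add: branch_def)
  have "frob q 1 ?b1 = frob q (n + 1) (frob q n \<beta>)" "?c1 ^ k = frob q n (frob q n \<gamma> ^ k)" "?c1 = frob q n (frob q n \<gamma>)" for k
    by (simp_all add: mult_2 add.assoc)
  hence nth1: "fps_nth f 1 = - \<kappa> (frob q n \<beta>) (frob q n \<gamma>)"
    unfolding f_def surface_first_order[OF br] \<kappa>_def by (simp only: mult.commute)
  have "\<kappa> (frob q n \<beta>) (frob q n \<gamma>) = 0 \<longleftrightarrow>
     frob q n (frob q (2 * n) \<gamma>) = frob q n \<gamma> \<and> frob q n (frob q (2 * n) \<beta>) = frob q n \<beta>"
    using \<kappa>_eq_0_iff[of "frob q n \<beta>" "frob q n \<gamma>"] PQ by (simp add: on_curve_def add.commute)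
  hence "\<kappa> (frob q n \<beta>) (frob q n \<gamma>) \<noteq> 0" using moved by (metis K.frob_inj)
  hence "fps_nth f 1 \<noteq> 0" using nth1 by simp
  hence "f \<noteq> 0" and "subdegree f = 1"
    using nth0 by (auto intro!: subdegreeI simp: less_Suc_eq)
  thus ?thesis
    using ord_at_branch[OF P1 br, folded f_def] unfolding f_def by (simp add: one_enat_def)
qed

lemma zero_divisor_surface:
  assumes P: "on_curve \<alpha> \<beta> \<gamma>"
  shows "zero_divisor (gk_ideal q n) (surface_of \<alpha> \<beta> \<gamma>) R =
    of_nat (q ^ n) * of_bool (R = (\<alpha>, \<beta>, \<gamma>)) +
    of_bool (R = (frob q (2 * n) \<alpha>, frob q (2 * n) \<beta>, frob q (2 * n) \<gamma>))"
proof -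
  obtain x y z where R: "R = (x, y, z)" by (cases R)
  let ?P = "(\<alpha>, \<beta>, \<gamma>)" and ?P1 = "(frob q (2 * n) \<alpha>, frob q (2 * n) \<beta>, frob q (2 * n) \<gamma>)"
  define f where "f x y z = x + frob q n \<alpha> - frob q n \<beta> * y - poly Z (frob q n \<gamma> * z)" for x y z
  have P1: "on_curve (frob q (2 * n) \<alpha>) (frob q (2 * n) \<beta>) (frob q (2 * n) \<gamma>)" by (rule on_curve_frob[OF P])
  have zeros: "f x y z = 0 \<longleftrightarrow> (x, y, z) = ?P \<or> (x, y, z) = ?P1" if "on_curve x y z" for x y z
    unfolding f_def using surface_zeros[of x y z \<alpha> \<beta> \<gamma>] P that unfolding on_curve_def by blast
  have same: "?P1 = ?P \<longleftrightarrow> frob q (2 * n) \<gamma> = \<gamma> \<and> frob q (2 * n) \<beta> = \<beta>"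
  proof -
    have "f \<alpha> \<beta> \<gamma> = 0" "f (frob q (2 * n) \<alpha>) (frob q (2 * n) \<beta>) (frob q (2 * n) \<gamma>) = 0"
      using zeros[OF P] zeros[OF P1] by auto
    thus ?thesis unfolding f_def by auto (metis add_right_cancel diff_add_cancel)
  qed
  have curve: "R \<in> zero_locus (gk_ideal q n) \<longleftrightarrow> on_curve x y z"
    using on_curve_iff[of x y z] by (simp add: gk_curve_def R)
  consider "\<not> on_curve x y z" | "on_curve x y z" "R \<noteq> ?P" "R \<noteq> ?P1" | "R = ?P" | "R = ?P1" "R \<noteq> ?P" by blast
  thus ?thesis
  proof cases
    case 1
    hence "R \<noteq> ?P" "R \<noteq> ?P1" using P P1 by (auto simp: R)
    thus ?thesis using 1 curve by (simp add: zero_divisor_def)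
  next
    case 2
    obtain u v w where br: "branch x y z u v w" using branch_exists[OF 2(1)] by blast
    define h where "h = eval_at fps_const (u, v, w) (surface_of \<alpha> \<beta> \<gamma>)"
    have "fps_nth h 0 = f x y z"
      using br unfolding h_def f_def eval_at_fps_nth_0 eval3_eq_eval_at eval_at_surface[OF ring_map_id]
      by (simp add: branch_def)
    hence "fps_nth h 0 \<noteq> 0" using zeros[OF 2(1)] 2 by (simp add: R)
    hence "h \<noteq> 0" "subdegree h = 0" by auto
    hence "ord_at (gk_ideal q n) R (surface_of \<alpha> \<beta> \<gamma>) = 0"
      using ord_at_branch[OF 2(1) br, folded h_def] unfolding h_def R by (simp add: zero_enat_def)
    thus ?thesis using 2 curve by (simp add: zero_divisor_def)
  next
    case 3
    have on: "on_curve x y z" using 3 P by (simp add: R)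
    have eq: "?P1 = ?P \<longleftrightarrow> R = ?P1" unfolding 3 by (rule eq_commute)
    have "zero_divisor (gk_ideal q n) (surface_of \<alpha> \<beta> \<gamma>) R = (if ?P1 = ?P then enat (q ^ n + 1) else enat (q ^ n))"
      unfolding zero_divisor_def curve same using on ord_at_surface_base_point[OF P] by (simp only: 3 if_True)
    also have "\<dots> = of_nat (q ^ n) + of_bool (R = ?P1)"
      unfolding of_nat_eq_enat eq of_bool_def one_enat_def zero_enat_def by simp
    also have "of_nat (q ^ n) = of_nat (q ^ n) * (of_bool (R = ?P) :: enat)"
      unfolding 3 by simp
    finally show ?thesis .
  next
    case 4
    have on: "on_curve x y z" using 4(1) P1 by (simp add: R)
    have moved: "\<not> (frob q (2 * n) \<gamma> = \<gamma> \<and> frob q (2 * n) \<beta> = \<beta>)"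
      using 4 same by blast
    have "zero_divisor (gk_ideal q n) (surface_of \<alpha> \<beta> \<gamma>) R = 1"
      unfolding zero_divisor_def curve using on ord_at_surface_frobenius_image[OF P moved] by (simp only: 4(1) if_True)
    moreover have "of_bool (R = ?P) = (0 :: enat)" "of_bool (R = ?P1) = (1 :: enat)"
      using 4 by (simp_all only: of_bool_def if_True if_False simp_thms)
    ultimately show ?thesis by (simp only: mult_zero_right add_0_left)
  qed
qed

end

theorem theorem1p1:
  fixes q n :: nat
    and F :: "'f::{field, finite} poly poly"
    and Z :: "'f alg_closure poly"
    and \<alpha> \<beta> \<gamma> a b c :: "'f alg_closure"
  assumes "q = CARD('f)"
    and "n \<ge> 1" and "odd n"
    and "gk_F_identity q F"
    and "gk_Z_identity q n F Z"
    and "poly Z 0 = 0"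
    and "(\<alpha>, \<beta>, \<gamma>) \<in> gk_curve q n"
    and "a = \<alpha> ^ (q ^ n)" and "b = \<beta> ^ (q ^ n)" and "c = \<gamma> ^ (q ^ n)"
  shows "zero_divisor (gk_ideal q n) (gk_surface Z a b c) =
    (\<lambda>P. of_nat (q ^ n) * of_bool (P = (\<alpha>, \<beta>, \<gamma>)) +
         of_bool (P = (\<alpha> ^ (q ^ (2 * n)), \<beta> ^ (q ^ (2 * n)), \<gamma> ^ (q ^ (2 * n)))))"
proof -
  interpret gk_setting q n F Z
    by unfold_locales (rule assms)+
  have "on_curve \<alpha> \<beta> \<gamma>"
    using assms(7) by (simp add: on_curve_iff)
  from zero_divisor_surface[OF this] show ?thesis
    by (intro ext) (simp only: assms(8-10) frob_def)
qed

end
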